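(* Let $m, n$ be positive integers with $m > n$, $\gcd(m,n)=1$ and $m \not\equiv n \pmod 2$. If $mn \equiv 2 \pmod 4$ and $m > 30.8\, n$, then the equation $$(m^2-n^2)^x + (2mn)^y = (m^2+n^2)^z$$ has $(x,y,z)=(2,2,2)$ as its only solution in positive integers $x,y,z$. *)

theory Defs
  imports Complex_Main "HOL-Number_Theory.Cong"
begin

end

(*
  Write a = m^2 - n^2, b = 2mn, c = m^2 + n^2. Quadratic residue symbols modulo a prime factor of c
  that is 5 mod 8 show that x is even.

  If y >= 2, then z is even as well, and c^(z/2) = P^y + 4^(y-1) Q^y with 4PQ = b. For odd y this
  yields ((m+n)Q / p) = 1 for every prime p dividing c, whereas the product of these symbols is -1 by
  reciprocity; this is a biquadratic residue argument, made rational by extracting the square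
  root of a congruence P^y = -4^(y-1) Q^y (mod c). For even y >= 4 the equation becomes
  u^4 - v^4 = w^2, which is excluded by Fermat's descent, and y = 2 is settled by size.

  If y = 1, then z is odd, x and z are coprime, and t = x - z is odd. The case t = 1 fails modulo b^2,
  so t >= 3. As c / a is close to 1, this forces z to be at least about t log(a) m^2 / (2 n^2), which
  exceeds 1400 log(a), while z log(c / a) - t log(a) is positive and below b / a^x. Such a small linear form in
  two logarithms is refuted by Schneider's method: the pigeonhole principle gives a small integer
  combination of the functions binom(u, k) exp(l u log(a) / z) that is less than 1 on a large interval (denominators included). At the
  points u = rz + st it is close to the integer obtained by replacing exp(u log(a) / z) with a^r (c / a)^s,
  so that this integer is 0, which contradicts a zero estimate.
*)
theory Submission
  imports Defs "HOL-Number_Theory.Number_Theory" "HOL-Computational_Algebra.Nth_Powers"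
    "HOL-Analysis.Complex_Transcendental" "Jordan_Normal_Form.Determinant"
begin

section \<open>Power series majorants and the pigeonhole principle\<close>

text \<open>Schneider's form suits this: functions are evaluated but never differentiated, and since
  \<open>a\<close> and \<open>c / a\<close> are rational, clearing denominators reduces Liouville's
  inequality to the fact that an integer below 1 in absolute value is 0. The auxiliary function is
  not first made to vanish at chosen points and then extrapolated by a Schwarz lemma. The pigeonhole
  principle acts on its Taylor coefficients, so it is small on the whole interval at once, and real
  power series with absolute bounds are enough. Weights are averaged over degrees and frequencies,
  because maxima in their place would exceed the available margin. Coprimality of \<open>z\<close>
  and \<open>t\<close> is what keeps the points \<open>r z + s t\<close> distinct, so that there are
  enough of them for the zero estimate.\<close>

text \<open>A weighted l1 norm of the Taylor coefficients at radius \<open>r\<close>, as in a Wiener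
  algebra. It is submultiplicative and bounds both the function and each coefficient, so sums of
  absolute values take the place of Cauchy estimates on a complex disc.\<close>

definition majorized :: "real \<Rightarrow> real \<Rightarrow> (real \<Rightarrow> real) \<Rightarrow> bool" where
  "majorized r D f \<longleftrightarrow> (\<exists>e. summable (\<lambda>j. \<bar>e j\<bar> * r ^ j) \<and> (\<Sum>j. \<bar>e j\<bar> * r ^ j) \<le> D \<and>
      (\<forall>u. \<bar>u\<bar> \<le> r \<longrightarrow> (\<lambda>j. e j * u ^ j) sums f u))"

lemma majorized_mono: "majorized r D f \<Longrightarrow> D \<le> E \<Longrightarrow> majorized r E f"
  unfolding majorized_def by force

lemma majorized_cmult:
  assumes "majorized r D f"
  shows "majorized r (\<bar>s\<bar> * D) (\<lambda>u. s * f u)"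
proof -
  obtain e where e: "summable (\<lambda>j. \<bar>e j\<bar> * r ^ j)" "(\<Sum>j. \<bar>e j\<bar> * r ^ j) \<le> D"
      "\<And>u. \<bar>u\<bar> \<le> r \<Longrightarrow> (\<lambda>j. e j * u ^ j) sums f u"
    using assms unfolding majorized_def by blast
  have eq: "\<bar>s * e j\<bar> * r ^ j = \<bar>s\<bar> * (\<bar>e j\<bar> * r ^ j)" for j
    by (simp add: abs_mult)
  have "summable (\<lambda>j. \<bar>s * e j\<bar> * r ^ j)"
    unfolding eq using e(1) by (rule summable_mult)
  moreover have "(\<Sum>j. \<bar>s * e j\<bar> * r ^ j) \<le> \<bar>s\<bar> * D"
    unfolding eq suminf_mult[OF e(1)] using e(2) by (simp add: mult_left_mono)
  moreover have "(\<lambda>j. s * e j * u ^ j) sums (s * f u)" if "\<bar>u\<bar> \<le> r" for u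
    using sums_mult[OF e(3)[OF that], of s] by (simp add: mult.assoc)
  ultimately show ?thesis
    unfolding majorized_def by (intro exI[of _ "\<lambda>j. s * e j"]) auto
qed

text \<open>Each coefficient of the Cauchy product is dominated by the corresponding coefficient of
  the product of the two majorants.\<close>

lemma majorized_mult:
  assumes "0 \<le> r" "majorized r D f" "majorized r E g"
  shows "majorized r (D * E) (\<lambda>u. f u * g u)"
proof -
  obtain a where a: "summable (\<lambda>j. \<bar>a j\<bar> * r ^ j)" "(\<Sum>j. \<bar>a j\<bar> * r ^ j) \<le> D"
      "\<And>u. \<bar>u\<bar> \<le> r \<Longrightarrow> (\<lambda>j. a j * u ^ j) sums f u"
    using assms unfolding majorized_def by blast
  obtain b where b: "summable (\<lambda>j. \<bar>b j\<bar> * r ^ j)" "(\<Sum>j. \<bar>b j\<bar> * r ^ j) \<le> E"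
      "\<And>u. \<bar>u\<bar> \<le> r \<Longrightarrow> (\<lambda>j. b j * u ^ j) sums g u"
    using assms unfolding majorized_def by blast
  define c where "c = (\<lambda>k. \<Sum>i\<le>k. a i * b (k - i))"
  have conv: "(\<Sum>i\<le>k. a i * u ^ i * (b (k - i) * u ^ (k - i))) = c k * u ^ k" for k and u :: real
  proof -
    have "a i * u ^ i * (b (k - i) * u ^ (k - i)) = a i * b (k - i) * u ^ k" if "i \<le> k" for i
    proof -
      have "u ^ i * u ^ (k - i) = u ^ k" using that by (simp flip: power_add)
      then show ?thesis by (simp add: ac_simps)
    qed
    then show ?thesis unfolding c_def sum_distrib_right by (intro sum.cong) auto
  qed
  have sa: "summable (\<lambda>k. norm (a k * u ^ k))" if "\<bar>u\<bar> \<le> r" for u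
    by (rule summable_comparison_test'[OF a(1), of 0])
       (use that in \<open>auto simp: abs_mult power_abs intro!: mult_left_mono power_mono\<close>)
  have sb: "summable (\<lambda>k. norm (b k * u ^ k))" if "\<bar>u\<bar> \<le> r" for u
    by (rule summable_comparison_test'[OF b(1), of 0])
       (use that in \<open>auto simp: abs_mult power_abs intro!: mult_left_mono power_mono\<close>)
  have cs: "(\<lambda>k. c k * u ^ k) sums (f u * g u)" if "\<bar>u\<bar> \<le> r" for u
    using Cauchy_product_sums[OF sa[OF that] sb[OF that]]
    unfolding conv using a(3)[OF that] b(3)[OF that] by (simp add: sums_iff)
  let ?a = "\<lambda>k. \<bar>a k\<bar> * r ^ k" and ?b = "\<lambda>k. \<bar>b k\<bar> * r ^ k"
  have na: "summable (\<lambda>k. norm (?a k))" and nb: "summable (\<lambda>k. norm (?b k))"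
    using a(1) b(1) assms(1) by (simp_all add: abs_mult)
  have P: "(\<lambda>k. \<Sum>i\<le>k. ?a i * ?b (k - i)) sums ((\<Sum>k. ?a k) * (\<Sum>k. ?b k))"
    by (rule Cauchy_product_sums[OF na nb])
  have le: "\<bar>c k\<bar> * r ^ k \<le> (\<Sum>i\<le>k. ?a i * ?b (k - i))" for k
  proof -
    have "\<bar>c k\<bar> * r ^ k = \<bar>\<Sum>i\<le>k. a i * r ^ i * (b (k - i) * r ^ (k - i))\<bar>"
      unfolding conv using assms(1) by (simp add: abs_mult)
    also have "\<dots> \<le> (\<Sum>i\<le>k. \<bar>a i * r ^ i * (b (k - i) * r ^ (k - i))\<bar>)"
      by (rule sum_abs)
    also have "\<dots> = (\<Sum>i\<le>k. ?a i * ?b (k - i))"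
      using assms(1) by (simp add: abs_mult)
    finally show ?thesis .
  qed
  have sc: "summable (\<lambda>k. \<bar>c k\<bar> * r ^ k)"
    by (rule summable_comparison_test'[OF sums_summable[OF P], of 0])
       (use le assms(1) in \<open>simp add: abs_mult\<close>)
  have "(\<Sum>k. \<bar>c k\<bar> * r ^ k) \<le> (\<Sum>k. ?a k) * (\<Sum>k. ?b k)"
    using suminf_le[OF le sc sums_summable[OF P]] P by (simp add: sums_iff)
  also have "\<dots> \<le> D * E"
    using a b assms(1) by (intro mult_mono) (auto intro!: suminf_nonneg order_trans[OF suminf_nonneg a(2)])
  finally show ?thesis
    unfolding majorized_def using sc cs by (intro exI[of _ c]) auto
qed

lemma majorized_linear:
  assumes "0 \<le> r"
  shows "majorized r (r + \<bar>w\<bar>) (\<lambda>u. u - w)"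
proof -
  define e :: "nat \<Rightarrow> real" where "e = (\<lambda>j. if j = 0 then - w else if j = 1 then 1 else 0)"
  have s: "(\<lambda>j. e j * u ^ j) sums (u - w)" for u
    using sums_finite[of "{0,1}" "\<lambda>j. e j * u ^ j"] by (auto simp: e_def)
  have s': "(\<lambda>j. \<bar>e j\<bar> * r ^ j) sums (r + \<bar>w\<bar>)"
    using sums_finite[of "{0,1}" "\<lambda>j. \<bar>e j\<bar> * r ^ j"] by (auto simp: e_def add.commute)
  show ?thesis
    unfolding majorized_def using s s' by (intro exI[of _ e]) (auto simp: sums_iff)
qed

lemma majorized_exp:
  assumes "0 \<le> r"
  shows "majorized r (exp (\<bar>w\<bar> * r)) (\<lambda>u. exp (w * u))"
proof -
  have s: "(\<lambda>j. w ^ j / fact j * u ^ j) sums exp (w * u)" for w u :: real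
    using exp_converges[of "w * u"] by (simp add: power_mult_distrib divide_simps)
  have s': "(\<lambda>j. \<bar>w ^ j / fact j\<bar> * r ^ j) sums exp (\<bar>w\<bar> * r)"
    using s[of "\<bar>w\<bar>" r] by (simp add: power_abs)
  show ?thesis
    unfolding majorized_def using s s' by (intro exI[of _ "\<lambda>j. w ^ j / fact j"]) (auto simp: sums_iff)
qed

text \<open>The factors \<open>(u - i) / (i + 1)\<close> are majorized one by one; replacing every
  \<open>i\<close> by the common bound \<open>K\<close> leaves a pure power over a
  factorial.\<close>

lemma majorized_gbinomial:
  assumes "0 \<le> r" "k \<le> K"
  shows "majorized r ((r + real K) ^ k / fact k) (\<lambda>u. u gchoose k)"
  using assms(2)
proof (induction k)
  case 0
  have "majorized r 1 (\<lambda>u. 1)"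
    using majorized_exp[OF assms(1), of 0] by simp
  then show ?case by simp
next
  case (Suc k)
  have "majorized r (\<bar>1 / (Suc k)\<bar> * ((r + K) ^ k / fact k * (r + \<bar>real k\<bar>)))
          (\<lambda>u. 1 / Suc k * ((u gchoose k) * (u - real k)))"
    using Suc by (intro majorized_cmult majorized_mult majorized_linear assms(1)) auto
  moreover have "1 / real (Suc k) * ((u gchoose k) * (u - real k)) = (u gchoose Suc k)" for u :: real
    using gbinomial_mult_1[of u k] by (simp add: field_simps)
  moreover have "\<bar>1 / (Suc k)\<bar> * ((r + K) ^ k / fact k * (r + \<bar>real k\<bar>)) \<le> (r + K) ^ Suc k / fact (Suc k)"
  proof -
    have "(r + K) ^ k * (r + real k) \<le> (r + K) ^ k * (r + K)"
      using Suc.prems assms(1) by (intro mult_left_mono) auto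
    then show ?thesis by (simp add: field_simps del: of_nat_Suc)
  qed
  ultimately show ?case
    using majorized_mono by (metis (no_types, lifting) ext)
qed

text \<open>By \<open>K ^ k / fact k \<le> exp K\<close> the factorial disappears and the bound
  becomes geometric in \<open>k\<close>. With \<open>\<mu> = (r + K) / K\<close> its logarithm
  averages to \<open>(K - 1) / 2 * ln \<mu> + K\<close> over \<open>k < K\<close>.\<close>

lemma majorized_gbinomial':
  assumes "0 \<le> r" "k \<le> K" "0 < (K :: nat)"
  shows "majorized r (((r + K) / K) ^ k * exp K) (\<lambda>u. u gchoose k)"
proof (rule majorized_mono[OF majorized_gbinomial[OF assms(1,2)]])
  have "real K ^ k / fact k \<le> exp K"
    using sum_le_suminf[OF summable_exp[of "real K"], of "{k}"] by (simp add: exp_def field_simps)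
  then have "((r + K) / K) ^ k * (real K ^ k / fact k) \<le> ((r + K) / K) ^ k * exp K"
    using assms by (intro mult_left_mono) auto
  moreover have "((r + K) / K) ^ k * (real K ^ k / fact k) = (r + K) ^ k / fact k"
    using assms by (simp add: power_divide)
  ultimately show "(r + K) ^ k / fact k \<le> ((r + K) / K) ^ k * exp K" by simp
qed

lemma majorized_coeffs:
  assumes "majorized r D f" "0 < r"
  shows "\<exists>e. (\<forall>j. \<bar>e j\<bar> \<le> D / r ^ j) \<and> (\<forall>u. \<bar>u\<bar> \<le> r \<longrightarrow> (\<lambda>j. e j * u ^ j) sums f u)"
proof -
  obtain a where a: "summable (\<lambda>j. \<bar>a j\<bar> * r ^ j)" "(\<Sum>j. \<bar>a j\<bar> * r ^ j) \<le> D"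
      "\<And>u. \<bar>u\<bar> \<le> r \<Longrightarrow> (\<lambda>j. a j * u ^ j) sums f u"
    using assms unfolding majorized_def by blast
  have "\<bar>a j\<bar> * r ^ j \<le> D" for j
    using sum_le_suminf[OF a(1), of "{j}"] a(2) assms(2) by simp
  then have "\<bar>a j\<bar> \<le> D / r ^ j" for j
    using assms(2) by (simp add: field_simps)
  then show ?thesis using a(3) by blast
qed

lemma majorized_bound:
  assumes "majorized r D f" "\<bar>u\<bar> \<le> r"
  shows "\<bar>f u\<bar> \<le> D"
proof -
  obtain a where a: "summable (\<lambda>j. \<bar>a j\<bar> * r ^ j)" "(\<Sum>j. \<bar>a j\<bar> * r ^ j) \<le> D"
      "(\<lambda>j. a j * u ^ j) sums f u"
    using assms unfolding majorized_def by blast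
  have le: "norm (a j * u ^ j) \<le> \<bar>a j\<bar> * r ^ j" for j
    using assms(2) by (auto simp: abs_mult power_abs intro!: mult_left_mono power_mono)
  have "\<bar>f u\<bar> \<le> (\<Sum>j. \<bar>a j\<bar> * r ^ j)"
    using summable_rabs_comparison_test[of "\<lambda>j. a j * u ^ j"] norm_suminf_le[OF le a(1)] a(3)
    by (simp add: sums_iff)
  then show ?thesis using a(2) by simp
qed

section \<open>Small integer combinations of power series\<close>

lemma pigeonhole_PiE:
  fixes f :: "('i \<Rightarrow> nat) \<Rightarrow> nat \<Rightarrow> int"
  assumes "finite I" "finite J"
    and "\<And>n j. n \<in> (\<Pi>\<^sub>E i\<in>I. {..H i}) \<Longrightarrow> j \<in> J \<Longrightarrow> f n j \<in> B j"
    and "\<And>j. j \<in> J \<Longrightarrow> finite (B j)"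
    and "(\<Prod>j\<in>J. card (B j)) < (\<Prod>i\<in>I. Suc (H i))"
  shows "\<exists>n n'. n \<in> (\<Pi>\<^sub>E i\<in>I. {..H i}) \<and> n' \<in> (\<Pi>\<^sub>E i\<in>I. {..H i}) \<and> n \<noteq> n' \<and> (\<forall>j\<in>J. f n j = f n' j)"
proof -
  let ?A = "\<Pi>\<^sub>E i\<in>I. {..H i}"
  let ?F = "\<lambda>n. restrict (f n) J"
  have "?F ` ?A \<subseteq> (\<Pi>\<^sub>E j\<in>J. B j)"
    using assms(3) by auto
  then have "card (?F ` ?A) \<le> card (\<Pi>\<^sub>E j\<in>J. B j)"
    by (intro card_mono finite_PiE assms) auto
  also have "\<dots> < card ?A"
    using assms by (simp add: card_PiE)
  finally have "\<not> inj_on ?F ?A"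
    by (rule pigeonhole)
  then obtain n n' where n: "n \<in> ?A" "n' \<in> ?A" "n \<noteq> n'" "?F n = ?F n'"
    unfolding inj_on_def by blast
  have "f n j = f n' j" if "j \<in> J" for j
    using fun_cong[OF n(4), of j] that by simp
  then show ?thesis using n by blast
qed

text \<open>A Siegel lemma for functions. Pigeonhole makes the first \<open>N\<close> Taylor
  coefficients of the combination small; the later ones are small anyway, being at most
  \<open>\<rho> ^ N / (8 * \<rho> ^ j)\<close>. Each group contributes at most 1/4 on
  \<open>[-1, 1]\<close>. Scaling the range of \<open>n i\<close> by \<open>1 / D i\<close> lets
  only the sum of the \<open>ln (D i)\<close> enter \<open>main\<close>.\<close>

lemma small_integer_combination:
  fixes e :: "'i \<Rightarrow> nat \<Rightarrow> real" and D :: "'i \<Rightarrow> real" and \<rho> :: real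
  assumes I: "finite I" "card I = N" "N > 0" and \<rho>: "\<rho> \<ge> 2"
    and D: "\<And>i. i \<in> I \<Longrightarrow> D i > 0"
    and e: "\<And>i j. i \<in> I \<Longrightarrow> \<bar>e i j\<bar> \<le> D i / \<rho> ^ j"
    and main: "(\<Sum>i\<in>I. ln (D i)) + real N * ln (24 * real N ^ 2) < real N * (real N - 1) / 2 * ln \<rho>"
  shows "\<exists>n :: 'i \<Rightarrow> int. (\<exists>i\<in>I. n i \<noteq> (0 :: int)) \<and> (\<forall>i\<in>I. \<bar>real_of_int (n i)\<bar> * D i \<le> \<rho> ^ N / (8 * real N)) \<and>
           (\<forall>u. \<bar>u\<bar> \<le> 1 \<longrightarrow> \<bar>\<Sum>i\<in>I. real_of_int (n i) * (\<Sum>j. e i j * u ^ j)\<bar> \<le> 1 / 2)"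
proof -
  \<comment> \<open>The factor \<open>8 N\<close> bounds the tail from index \<open>N\<close> on by
    \<open>(1/8) / (1 - 1/\<rho>)\<close>, which is at most 1/4 as
    \<open>\<rho> \<ge> 2\<close>.\<close>
  define C where "C = \<rho> ^ N / (8 * real N)"
  define H where "H = (\<lambda>i. nat \<lfloor>C / D i\<rfloor>)"
  have C: "C > 0" using \<rho> I by (simp add: C_def)
  have H1: "real (H i) * D i \<le> C" if "i \<in> I" for i
  proof -
    have "real (H i) \<le> C / D i"
      unfolding H_def using C D[OF that] by (simp add: of_nat_nat)
    then show ?thesis using D[OF that] by (simp add: field_simps)
  qed
  have H2: "C / D i < real (Suc (H i))" if "i \<in> I" for i
    unfolding H_def using C D[OF that] by (simp add: of_nat_nat) linarith
  define v where "v = (\<lambda>(n :: 'i \<Rightarrow> nat) j. \<Sum>i\<in>I. real (n i) * e i j)"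
  \<comment> \<open>Equal floors mean that two combinations differ by at most
    \<open>1 / (4 N)\<close> in a coefficient, so the first \<open>N\<close> coefficients of the
    difference contribute at most 1/4.\<close>
  define f where "f = (\<lambda>n j. \<lfloor>4 * real N * v n j\<rfloor>)"
  define V where "V = (\<lambda>j. real N * C / \<rho> ^ j)"
  have coeff_bound: "\<bar>x\<bar> * \<bar>e i j\<bar> \<le> C / \<rho> ^ j" if "i \<in> I" "\<bar>x\<bar> * D i \<le> C" for x :: real and i j
  proof -
    have "\<bar>x\<bar> * \<bar>e i j\<bar> \<le> \<bar>x\<bar> * (D i / \<rho> ^ j)"
      using e[OF that(1)] by (intro mult_left_mono) auto
    also have "\<dots> = (\<bar>x\<bar> * D i) / \<rho> ^ j" by simp
    also have "\<dots> \<le> C / \<rho> ^ j"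
      using that(2) \<rho> by (intro divide_right_mono) auto
    finally show ?thesis .
  qed
  have vV: "\<bar>v n j\<bar> \<le> V j" if "n \<in> (\<Pi>\<^sub>E i\<in>I. {..H i})" for n j
  proof -
    have "\<bar>v n j\<bar> \<le> (\<Sum>i\<in>I. \<bar>real (n i)\<bar> * \<bar>e i j\<bar>)"
      unfolding v_def by (rule order_trans[OF sum_abs]) (simp add: abs_mult)
    also have "\<dots> \<le> (\<Sum>i\<in>I. C / \<rho> ^ j)"
    proof (rule sum_mono)
      fix i assume i: "i \<in> I"
      have "real (n i) * D i \<le> real (H i) * D i"
        using that i D[OF i] by (intro mult_right_mono) (auto simp: PiE_iff)
      then show "\<bar>real (n i)\<bar> * \<bar>e i j\<bar> \<le> C / \<rho> ^ j"
        using H1[OF i] by (intro coeff_bound i) simp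
    qed
    also have "\<dots> = V j" using I by (simp add: V_def)
    finally show ?thesis .
  qed
  define B where "B = (\<lambda>j. {- \<lceil>4 * real N * V j\<rceil> .. \<lfloor>4 * real N * V j\<rfloor>})"
  have Bm: "f n j \<in> B j" if "n \<in> (\<Pi>\<^sub>E i\<in>I. {..H i})" for n j
  proof -
    have "\<bar>4 * real N * v n j\<bar> \<le> 4 * real N * V j"
      using vV[OF that, of j] I(3) by (simp add: abs_mult)
    then have "4 * real N * v n j \<le> 4 * real N * V j" "- (4 * real N * V j) \<le> 4 * real N * v n j"
      by linarith+
    then show ?thesis unfolding B_def f_def ceiling_def by (auto intro: floor_mono)
  qed
  have cB: "real (card (B j)) \<le> 3 * real N * \<rho> ^ (N - j)" if "j < N" for j
  proof -
    have V: "4 * real N * V j = real N * \<rho> ^ (N - j) / 2"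
      using that \<rho> I(3) by (simp add: V_def C_def power_diff)
    have "1 \<le> \<rho> ^ (N - j)" using \<rho> by (intro one_le_power) auto
    then have X: "1 * 1 \<le> real N * \<rho> ^ (N - j)" using I(3) by (intro mult_mono) auto
    have "real (card (B j)) = of_int (\<lfloor>4 * real N * V j\<rfloor> + \<lceil>4 * real N * V j\<rceil> + 1)"
    proof -
      have "4 * real N * V j \<ge> 0" unfolding V using X by linarith
      then have "0 \<le> \<lfloor>4 * real N * V j\<rfloor>" "0 \<le> \<lceil>4 * real N * V j\<rceil>" by simp_all
      then show ?thesis unfolding B_def by simp
    qed
    also have "\<dots> \<le> 2 * (real N * \<rho> ^ (N - j) / 2) + 2"
      unfolding V[symmetric] by linarith
    also have "\<dots> \<le> 3 * real N * \<rho> ^ (N - j)" using X by simp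
    finally show ?thesis .
  qed
  \<comment> \<open>There are at most \<open>(3 N)^N \<rho>^(N (N + 1) / 2)\<close> boxes, and more
    than \<open>\<rho>^(N^2) / (8 N)^N\<close> divided by the product of the \<open>D i\<close>
    candidates. In logarithms this comparison is \<open>main\<close>, with \<open>24 N^2\<close>
    arising as \<open>3 N\<close> times \<open>8 N\<close>.\<close>
  have "real (\<Prod>j<N. card (B j)) < real (\<Prod>i\<in>I. Suc (H i))"
  proof -
    have "real (\<Prod>j<N. card (B j)) \<le> (\<Prod>j<N. 3 * real N * \<rho> ^ (N - j))"
      unfolding of_nat_prod using cB by (intro prod_mono) auto
    also have "\<dots> = exp (\<Sum>j<N. ln (3 * real N) + real (N - j) * ln \<rho>)"
    proof -
      have "3 * real N * \<rho> ^ (N - j) = exp (ln (3 * real N) + real (N - j) * ln \<rho>)" for j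
        using I(3) \<rho> by (simp add: exp_add exp_of_nat_mult)
      then show ?thesis by (simp add: exp_sum)
    qed
    also have "(\<Sum>j<N. ln (3 * real N) + real (N - j) * ln \<rho>)
        = real N * ln (3 * real N) + real N * (real N + 1) / 2 * ln \<rho>"
    proof -
      have "(\<Sum>j<n. real (n - j)) = real n * (real n + 1) / 2" for n
      proof (induction n)
        case (Suc n)
        have "(\<Sum>j<Suc n. real (Suc n - j)) = real (Suc n) + (\<Sum>j<n. real (n - j))"
          by (subst sum.lessThan_Suc_shift) simp
        then show ?case using Suc by (simp add: field_simps)
      qed simp
      then show ?thesis by (simp add: sum.distrib flip: sum_distrib_right)
    qed
    also have "exp \<dots> < exp (\<Sum>i\<in>I. ln (C / D i))"
    proof -
      have "(\<Sum>i\<in>I. ln (C / D i)) = real N * ln C - (\<Sum>i\<in>I. ln (D i))"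
      proof -
        have "(\<Sum>i\<in>I. ln (C / D i)) = (\<Sum>i\<in>I. ln C - ln (D i))"
          using C D by (intro sum.cong) (auto simp: ln_div dest: D)
        then show ?thesis using I(2) by (simp add: sum_subtractf)
      qed
      moreover have "ln C = real N * ln \<rho> - ln (8 * real N)"
        using \<rho> I(3) by (simp add: C_def ln_div ln_realpow)
      moreover have "ln (24 * real N ^ 2) = ln (3 * real N) + ln (8 * real N)"
        using I(3) ln_mult[of "3 * real N" "8 * real N"] by (simp add: power2_eq_square)
      ultimately show ?thesis using main by (simp add: field_simps power2_eq_square)
    qed
    also have "\<dots> = (\<Prod>i\<in>I. C / D i)"
      using C D I(1) by (subst exp_sum) (auto intro!: prod.cong)
    also have "\<dots> \<le> (\<Prod>i\<in>I. real (Suc (H i)))"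
      using H2 C D by (intro prod_mono) (auto simp: less_imp_le)
    finally show ?thesis by simp
  qed
  then have "(\<Prod>j<N. card (B j)) < (\<Prod>i\<in>I. Suc (H i))"
    by linarith
  then obtain n n' where nn: "n \<in> (\<Pi>\<^sub>E i\<in>I. {..H i})" "n' \<in> (\<Pi>\<^sub>E i\<in>I. {..H i})" "n \<noteq> n'"
      "\<forall>j\<in>{..<N}. f n j = f n' j"
    using pigeonhole_PiE[of I "{..<N}" H f B] Bm I(1) unfolding B_def by blast
  define d where "d = (\<lambda>i. int (n i) - int (n' i))"
  have d1: "\<exists>i\<in>I. d i \<noteq> 0"
    using nn(1-3) PiE_ext unfolding d_def by fastforce
  have d2: "\<bar>real_of_int (d i)\<bar> * D i \<le> C" if "i \<in> I" for i
  proof -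
    have "n i \<le> H i" "n' i \<le> H i"
      using nn(1,2) that by (auto simp: PiE_iff)
    then have "\<bar>real_of_int (d i)\<bar> \<le> real (H i)"
      unfolding d_def by simp
    then show ?thesis
      using H1[OF that] D[OF that] by (meson mult_right_mono less_imp_le order_trans)
  qed
  define g where "g = (\<lambda>j. \<Sum>i\<in>I. of_int (d i) * e i j)"
  have g_small: "\<bar>g j\<bar> \<le> 1 / (4 * real N)" if "j < N" for j
  proof -
    have "g j = v n j - v n' j"
      by (simp add: g_def v_def d_def sum_subtractf left_diff_distrib)
    moreover have "\<lfloor>4 * real N * v n j\<rfloor> = \<lfloor>4 * real N * v n' j\<rfloor>"
      using nn(4) that unfolding f_def by simp
    then have "\<bar>4 * real N * v n j - 4 * real N * v n' j\<bar> \<le> 1"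
      by linarith
    ultimately have "4 * real N * \<bar>g j\<bar> \<le> 1"
      by (simp add: abs_mult flip: right_diff_distrib)
    then show ?thesis using I(3) by (simp add: field_simps)
  qed
  have g_bd: "\<bar>g j\<bar> \<le> 1 / 8 * (\<rho> ^ N / \<rho> ^ j)" for j
  proof -
    have "\<bar>g j\<bar> \<le> (\<Sum>i\<in>I. \<bar>of_int (d i)\<bar> * \<bar>e i j\<bar>)"
      unfolding g_def by (rule order_trans[OF sum_abs]) (simp add: abs_mult)
    also have "\<dots> \<le> (\<Sum>i\<in>I. C / \<rho> ^ j)"
      using coeff_bound d2 by (intro sum_mono) auto
    also have "\<dots> = 1 / 8 * (\<rho> ^ N / \<rho> ^ j)" using I by (simp add: C_def)
    finally show ?thesis .
  qed
  have "\<bar>\<Sum>i\<in>I. of_int (d i) * (\<Sum>j. e i j * u ^ j)\<bar> \<le> 1 / 2" if u: "\<bar>u\<bar> \<le> 1" for u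
  proof -
    have geo: "(\<lambda>j. x * (1 / \<rho>) ^ j) sums (x * (1 / (1 - 1 / \<rho>)))" for x :: real
      using \<rho> by (intro sums_mult geometric_sums) auto
    have pu: "\<bar>u\<bar> ^ j \<le> 1" for j using u by (simp add: power_le_one)
    have su: "summable (\<lambda>j. e i j * u ^ j)" if "i \<in> I" for i
    proof (rule summable_comparison_test'[OF sums_summable[OF geo[of "D i"]], of 0])
      fix j
      have "norm (e i j * u ^ j) \<le> \<bar>e i j\<bar> * 1"
        unfolding real_norm_def abs_mult power_abs using pu by (intro mult_left_mono) auto
      also have "\<dots> \<le> D i * (1 / \<rho>) ^ j" using e[OF that, of j] by (simp add: power_divide)
      finally show "norm (e i j * u ^ j) \<le> D i * (1 / \<rho>) ^ j" .
    qed
    have "(\<lambda>j. \<Sum>i\<in>I. of_int (d i) * (e i j * u ^ j)) sums (\<Sum>i\<in>I. of_int (d i) * (\<Sum>j. e i j * u ^ j))"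
      using su by (intro sums_sum sums_mult summable_sums)
    then have gs: "(\<lambda>j. g j * u ^ j) sums (\<Sum>i\<in>I. of_int (d i) * (\<Sum>j. e i j * u ^ j))"
      by (simp add: g_def sum_distrib_right mult.assoc)
    have term1: "\<bar>g j * u ^ j\<bar> \<le> \<bar>g j\<bar>" for j
      unfolding abs_mult power_abs using pu[of j] by (simp add: mult_left_le)
    have head: "\<bar>\<Sum>j<N. g j * u ^ j\<bar> \<le> 1 / 4"
    proof -
      have "\<bar>\<Sum>j<N. g j * u ^ j\<bar> \<le> (\<Sum>j<N. 1 / (4 * real N))"
        by (rule order_trans[OF sum_abs sum_mono]) (use term1 g_small order_trans in blast)
      then show ?thesis using I(3) by simp
    qed
    have tail_le: "norm (g (j + N) * u ^ (j + N)) \<le> 1 / 8 * (1 / \<rho>) ^ j" for j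
      using order_trans[OF term1[of "j + N"] g_bd[of "j + N"]] \<rho> by (simp add: power_add power_divide)
    have "norm (\<Sum>j. g (j + N) * u ^ (j + N)) \<le> (\<Sum>j. 1 / 8 * (1 / \<rho>) ^ j)"
      by (rule norm_suminf_le[OF tail_le sums_summable[OF geo]])
    also have "\<dots> = 1 / 8 * (1 / (1 - 1 / \<rho>))" by (rule sums_unique[OF geo, symmetric])
    also have "\<dots> \<le> 1 / 4" using \<rho> by (simp add: field_simps)
    finally have tail: "\<bar>\<Sum>j. g (j + N) * u ^ (j + N)\<bar> \<le> 1 / 4" by simp
    have "(\<Sum>i\<in>I. of_int (d i) * (\<Sum>j. e i j * u ^ j)) = (\<Sum>j. g (j + N) * u ^ (j + N)) + (\<Sum>j<N. g j * u ^ j)"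
      using gs suminf_split_initial_segment[OF sums_summable[OF gs], of N] by (simp add: sums_iff)
    then show ?thesis using head tail by linarith
  qed
  then show ?thesis
    using d1 d2 unfolding C_def by (intro exI[of _ d]) auto
qed

section \<open>A zero estimate\<close>

text \<open>The coefficient is read at the sum of the bounds \<open>g i\<close>, not at the actual
  degree, so that all terms of a Leibniz expansion can be compared at one common exponent.\<close>

lemma coeff_prod_degree_bound:
  fixes f :: "'i \<Rightarrow> 'a::comm_semiring_1 poly"
  assumes "finite A" "\<And>i. i \<in> A \<Longrightarrow> degree (f i) \<le> g i"
  shows "degree (\<Prod>i\<in>A. f i) \<le> (\<Sum>i\<in>A. g i)
     \<and> coeff (\<Prod>i\<in>A. f i) (\<Sum>i\<in>A. g i) = (\<Prod>i\<in>A. coeff (f i) (g i))"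
  using assms
proof (induction A rule: finite_induct)
  case (insert a A)
  let ?p = "\<Prod>i\<in>A. f i" and ?n = "\<Sum>i\<in>A. g i"
  have IH: "degree ?p \<le> ?n" "coeff ?p ?n = (\<Prod>i\<in>A. coeff (f i) (g i))" and a: "degree (f a) \<le> g a"
    using insert by auto
  have "coeff (f a * ?p) (g a + ?n) = (\<Sum>i\<le>g a + ?n. if i = g a then coeff (f a) (g a) * coeff ?p ?n else 0)"
    unfolding coeff_mult
  proof (rule sum.cong)
    fix i assume i: "i \<in> {..g a + ?n}"
    consider "i < g a" | "i = g a" | "i > g a" by linarith
    then show "coeff (f a) i * coeff ?p (g a + ?n - i) = (if i = g a then coeff (f a) (g a) * coeff ?p ?n else 0)"
    proof cases
      case 1
      then have "degree ?p < g a + ?n - i" using IH(1) by linarith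
      then show ?thesis using 1 by (simp add: coeff_eq_0)
    next
      case 3
      then show ?thesis using a by (simp add: coeff_eq_0)
    qed auto
  qed simp
  moreover have "degree (f a * ?p) \<le> g a + ?n"
    using degree_mult_le[of "f a" ?p] IH(1) a by linarith
  ultimately show ?case using insert IH(2) by simp
qed simp

text \<open>A kernel vector of the transpose would be the coefficient vector of a nonzero polynomial
  of degree below \<open>n\<close> with the \<open>n\<close> distinct roots
  \<open>w j\<close>.\<close>

lemma det_vandermonde_nonzero:
  fixes w :: "nat \<Rightarrow> 'a::idom"
  assumes "inj_on w {..<n}"
  shows "det (mat n n (\<lambda>(i, j). w j ^ i)) \<noteq> 0"
proof
  let ?V = "mat n n (\<lambda>(i, j). w j ^ i)"
  have V: "?V \<in> carrier_mat n n" "transpose_mat ?V \<in> carrier_mat n n" by auto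
  assume "det ?V = 0"
  then have "det (transpose_mat ?V) = 0" using det_transpose[OF V(1)] by simp
  then obtain v where v: "v \<in> carrier_vec n" "v \<noteq> 0\<^sub>v n" "transpose_mat ?V *\<^sub>v v = 0\<^sub>v n"
    using det_0_iff_vec_prod_zero[OF V(2)] by blast
  define p where "p = (\<Sum>i<n. monom (v $ i) i)"
  have cp: "coeff p k = (if k < n then v $ k else 0)" for k
    by (simp add: p_def coeff_sum)
  have root: "poly p (w j) = 0" if "j < n" for j
  proof -
    have "(transpose_mat ?V *\<^sub>v v) $ j = (\<Sum>i = 0..<n. w j ^ i * v $ i)"
      using that v(1) by (auto simp: scalar_prod_def intro!: sum.cong)
    then show ?thesis
      using v(3) that by (simp add: p_def poly_sum poly_monom mult.commute lessThan_atLeast0)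
  qed
  have "p = 0"
  proof (rule ccontr)
    assume p: "p \<noteq> 0"
    have "n > 0" using v by (cases n) auto
    have "n = card (w ` {..<n})" using assms by (simp add: card_image)
    also have "\<dots> \<le> card {x. poly p x = 0}"
      using root p by (intro card_mono poly_roots_finite) auto
    also have "\<dots> \<le> degree p" by (rule card_poly_roots_bound[OF p])
    also have "\<dots> < n" using \<open>n > 0\<close> by (intro degree_lessI) (auto simp: cp)
    finally show False by simp
  qed
  then have "v $ i = 0" if "i < n" for i using cp[of i] that by simp
  then have "v = 0\<^sub>v n" using v(1) by (intro eq_vecI) auto
  then show False using v(2) by simp
qed

text \<open>For fixed \<open>x\<close> the equations say that the nonzero vector of powers
  \<open>y ^ l\<close> is annihilated by the matrix with entries
  \<open>\<eta> ^ (\<sigma> l) Q l (x + \<sigma> t)\<close>. So its determinant, a polynomial in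
  \<open>x\<close> of degree at most \<open>L d\<close>, vanishes on \<open>X\<close>. It is not the
  zero polynomial, because its top coefficient is a product of leading coefficients times a
  Vandermonde determinant in the distinct numbers \<open>\<eta> ^ l\<close>. The value
  \<open>y\<close> may depend on \<open>x\<close>, since it enters the kernel vector only.\<close>

lemma zero_estimate:
  fixes Q :: "nat \<Rightarrow> real poly" and \<eta> t :: real
  assumes \<eta>: "\<eta> > 1" and deg: "\<And>l. l < L \<Longrightarrow> degree (Q l) \<le> d"
    and nz: "\<exists>l<L. Q l \<noteq> 0"
    and X: "finite X" "L * d < card X"
    and zero: "\<And>x. x \<in> X \<Longrightarrow> \<exists>y. y \<noteq> 0 \<and>
        (\<forall>\<sigma><L. (\<Sum>l<L. poly (Q l) (x + real \<sigma> * t) * (y * \<eta> ^ \<sigma>) ^ l) = 0)"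
  shows False
proof -
  \<comment> \<open>A zero \<open>Q l\<close> would give a zero column, so only the nonzero
    polynomials are kept, together with as many shifts \<open>\<sigma> < n\<close> as there are
    columns.\<close>
  define ls where "ls = filter (\<lambda>l. Q l \<noteq> 0) [0..<L]"
  define n where "n = length ls"
  define e where "e = (\<lambda>i. ls ! i)"
  have set_ls: "set ls = {l. l < L \<and> Q l \<noteq> 0}" by (auto simp: ls_def)
  have bij: "bij_betw e {..<n} (set ls)"
    unfolding e_def by (rule bij_betw_nth) (auto simp: ls_def n_def)
  have e: "e i < L" "Q (e i) \<noteq> 0" if "i < n" for i
    using bij_betwE[OF bij] that set_ls by auto
  have n: "0 < n" "n \<le> L"
  proof -
    show "0 < n" using nz set_ls unfolding n_def by (metis (mono_tags, lifting) length_pos_if_in_set mem_Collect_eq)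
    show "n \<le> L" unfolding n_def ls_def using length_filter_le[of _ "[0..<L]"] by simp
  qed
  define q where "q = (\<lambda>\<sigma> i. smult (\<eta> ^ (\<sigma> * e i)) (Q (e i) \<circ>\<^sub>p [:real \<sigma> * t, 1:]))"
  define M where "M = mat n n (\<lambda>(\<sigma>, i). q \<sigma> i)"
  have M: "M \<in> carrier_mat n n" by (simp add: M_def)
  have perm_less: "p i < n" if "p permutes {0..<n}" "i < n" for p i
    using permutes_in_image[OF that(1), of i] that(2) by simp
  have Mdet: "det M = (\<Sum>p | p permutes {0..<n}. signof p * (\<Prod>i = 0..<n. q i (p i)))"
    unfolding det_def'[OF M] by (intro sum.cong prod.cong arg_cong2[of _ _ _ _ "(*)"]) (auto simp: M_def perm_less)
  define d' where "d' = (\<lambda>i. degree (Q (e i)))"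
  define S where "S = (\<Sum>i = 0..<n. d' i)"
  have dq: "degree (q \<sigma> i) \<le> d' i" "coeff (q \<sigma> i) (d' i) = lead_coeff (Q (e i)) * (\<eta> ^ e i) ^ \<sigma>" for \<sigma> i
  proof -
    have deg_eq: "degree (Q (e i) \<circ>\<^sub>p [:real \<sigma> * t, 1:]) = d' i"
      by (simp add: degree_pcompose d'_def)
    then show "degree (q \<sigma> i) \<le> d' i"
      unfolding q_def by (metis degree_smult_le)
    have "lead_coeff (Q (e i) \<circ>\<^sub>p [:real \<sigma> * t, 1:]) = lead_coeff (Q (e i))"
      by (subst lead_coeff_comp) auto
    then show "coeff (q \<sigma> i) (d' i) = lead_coeff (Q (e i)) * (\<eta> ^ e i) ^ \<sigma>"
      unfolding q_def using deg_eq by (simp add: mult.commute flip: power_mult)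
  qed
  have Sp: "(\<Sum>i = 0..<n. d' (p i)) = S" if "p permutes {0..<n}" for p
    unfolding S_def by (rule sum.permute[OF that, of d', unfolded comp_def, symmetric])
  have prodq: "degree (\<Prod>i = 0..<n. q i (p i)) \<le> S"
      "coeff (\<Prod>i = 0..<n. q i (p i)) S = (\<Prod>i = 0..<n. coeff (q i (p i)) (d' (p i)))"
    if "p permutes {0..<n}" for p
    using coeff_prod_degree_bound[of "{0..<n}" "\<lambda>i. q i (p i)" "\<lambda>i. d' (p i)"] dq(1) Sp[OF that] by auto
  have sg: "degree (signof p * r) \<le> degree r" "coeff (signof p * r) k = signof p * coeff r k" for p k and r :: "real poly"
    by (auto simp: sign_def)
  have degM: "degree (det M) \<le> S"
    unfolding Mdet using prodq(1) sg(1) by (intro degree_sum_le finite_permutations) (auto intro: order_trans)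
  define V where "V = mat n n (\<lambda>(i, j). (\<eta> ^ e j) ^ i)"
  have V: "V \<in> carrier_mat n n" by (simp add: V_def)
  \<comment> \<open>Translation preserves leading coefficients. Hence at top degree the rows differ
    only by powers of the numbers \<open>\<eta> ^ e j\<close>, and the coefficient at
    \<open>S\<close> is a column-scaled Vandermonde determinant.\<close>
  have "coeff (det M) S = (\<Sum>p | p permutes {0..<n}. signof p * (\<Prod>i = 0..<n. lead_coeff (Q (e (p i))) * (\<eta> ^ e (p i)) ^ i))"
    unfolding Mdet coeff_sum sg(2) using prodq(2) dq(2) by (intro sum.cong) auto
  also have "\<dots> = (\<Sum>p | p permutes {0..<n}. (\<Prod>i = 0..<n. lead_coeff (Q (e i))) * (signof p * (\<Prod>i = 0..<n. V $$ (i, p i))))"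
  proof (rule sum.cong)
    fix p assume "p \<in> {p. p permutes {0..<n}}"
    then have p: "p permutes {0..<n}" by simp
    have "(\<Prod>i = 0..<n. lead_coeff (Q (e (p i)))) = (\<Prod>i = 0..<n. lead_coeff (Q (e i)))"
      by (rule prod.permute[OF p, of "\<lambda>i. lead_coeff (Q (e i))", unfolded comp_def, symmetric])
    moreover have "(\<Prod>i = 0..<n. V $$ (i, p i)) = (\<Prod>i = 0..<n. (\<eta> ^ e (p i)) ^ i)"
      using p by (intro prod.cong) (auto simp: V_def perm_less)
    ultimately show "signof p * (\<Prod>i = 0..<n. lead_coeff (Q (e (p i))) * (\<eta> ^ e (p i)) ^ i) =
        (\<Prod>i = 0..<n. lead_coeff (Q (e i))) * (signof p * (\<Prod>i = 0..<n. V $$ (i, p i)))"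
      by (simp add: prod.distrib)
  qed simp
  also have "\<dots> = (\<Prod>i = 0..<n. lead_coeff (Q (e i))) * det V"
    unfolding det_def'[OF V] by (simp add: sum_distrib_left)
  finally have "coeff (det M) S = (\<Prod>i = 0..<n. lead_coeff (Q (e i))) * det V" .
  moreover have "det V \<noteq> 0"
    unfolding V_def
  proof (rule det_vandermonde_nonzero, rule inj_onI)
    fix i j assume ij: "i \<in> {..<n}" "j \<in> {..<n}" "\<eta> ^ e i = \<eta> ^ e j"
    then have "e i = e j" using \<eta> by (simp add: power_inject_exp)
    then show "i = j" using bij ij by (auto simp: bij_betw_def inj_on_def)
  qed
  ultimately have "coeff (det M) S \<noteq> 0" using e by simp
  then have D: "det M \<noteq> 0" by auto
  have "poly (det M) x = 0" if x: "x \<in> X" for x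
  proof -
    obtain y where y: "y \<noteq> 0" "\<And>\<sigma>. \<sigma> < L \<Longrightarrow> (\<Sum>l<L. poly (Q l) (x + real \<sigma> * t) * (y * \<eta> ^ \<sigma>) ^ l) = 0"
      using zero[OF x] by blast
    define W where "W = mat n n (\<lambda>(\<sigma>, i). poly (q \<sigma> i) x)"
    have W: "W \<in> carrier_mat n n" by (simp add: W_def)
    define v where "v = vec n (\<lambda>i. y ^ e i)"
    have "W *\<^sub>v v = 0\<^sub>v n"
    proof (rule eq_vecI)
      fix \<sigma> assume "\<sigma> < dim_vec (0\<^sub>v n :: real vec)"
      then have \<sigma>: "\<sigma> < n" by simp
      have "(W *\<^sub>v v) $ \<sigma> = (\<Sum>i<n. poly (q \<sigma> i) x * y ^ e i)"
        using \<sigma> by (auto simp: W_def v_def scalar_prod_def lessThan_atLeast0 intro!: sum.cong)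
      also have "\<dots> = (\<Sum>i<n. poly (Q (e i)) (x + real \<sigma> * t) * (y * \<eta> ^ \<sigma>) ^ e i)"
        by (intro sum.cong) (simp_all add: q_def poly_pcompose power_mult_distrib power_mult ac_simps)
      also have "\<dots> = (\<Sum>l\<in>set ls. poly (Q l) (x + real \<sigma> * t) * (y * \<eta> ^ \<sigma>) ^ l)"
        by (rule sum.reindex_bij_betw[OF bij])
      also have "\<dots> = (\<Sum>l<L. poly (Q l) (x + real \<sigma> * t) * (y * \<eta> ^ \<sigma>) ^ l)"
        using set_ls by (intro sum.mono_neutral_left) auto
      also have "\<dots> = 0" using y(2) \<sigma> n by simp
      finally show "(W *\<^sub>v v) $ \<sigma> = 0\<^sub>v n $ \<sigma>" using \<sigma> by simp
    qed (simp add: W_def)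
    moreover have "v \<in> carrier_vec n" "v \<noteq> 0\<^sub>v n"
    proof -
      show "v \<noteq> 0\<^sub>v n"
      proof
        assume "v = 0\<^sub>v n"
        then have "v $ 0 = 0" using n by simp
        then show False using n y(1) by (simp add: v_def)
      qed
    qed (simp add: v_def)
    ultimately have "det W = 0" using det_0_iff_vec_prod_zero[OF W] by blast
    moreover have "poly (det M) x = det W"
    proof -
      have ps: "poly (signof p * r) x = signof p * poly r x" for p and r :: "real poly"
        by (auto simp: sign_def)
      show ?thesis
        unfolding Mdet det_def'[OF W] poly_sum ps poly_prod
        by (intro sum.cong prod.cong arg_cong2[of _ _ _ _ "(*)"]) (auto simp: W_def perm_less)
    qed
    ultimately show ?thesis by simp
  qed
  then have "card X \<le> card {x. poly (det M) x = 0}"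
    using D by (intro card_mono poly_roots_finite) auto
  also have "\<dots> \<le> degree (det M)" by (rule card_poly_roots_bound[OF D])
  also have "\<dots> \<le> S" by (rule degM)
  also have "\<dots> \<le> n * d" unfolding S_def d'_def using deg e by (intro order_trans[OF sum_bounded_above[of _ _ d]]) auto
  also have "\<dots> \<le> L * d" using n by simp
  finally show False using X by simp
qed

section \<open>Powers that are too close\<close>

text \<open>Source of the mean absolute frequency \<open>M (M + 1) / L\<close> in the weight
  average.\<close>

lemma sum_abs_centred: "(\<Sum>j<2 * n + 1. \<bar>real j - real n\<bar>) = real n * (real n + 1)"
proof (induction n)
  case (Suc n)
  have "(\<Sum>j<Suc (2 * n + 2). \<bar>real j - real (Suc n)\<bar>)
      = real (Suc n) + (\<Sum>j<2 * n + 2. \<bar>real j - real n\<bar>)"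
    unfolding sum.lessThan_Suc_shift by simp
  also have "(\<Sum>j<2 * n + 2. \<bar>real j - real n\<bar>) = (\<Sum>j<2 * n + 1. \<bar>real j - real n\<bar>) + (real n + 1)"
    by simp
  finally show ?case using Suc by (simp add: algebra_simps)
qed simp

lemma exists_gchoose_poly: "\<exists>p :: real poly. degree p \<le> k \<and> (\<forall>x. poly p x = x gchoose k)"
proof (induction k)
  case 0
  show ?case by (intro exI[of _ 1]) auto
next
  case (Suc k)
  then obtain p :: "real poly" where p: "degree p \<le> k" "\<And>x. poly p x = x gchoose k" by blast
  let ?q = "smult (1 / real (Suc k)) (p * [:- real k, 1:])"
  have "degree ?q \<le> Suc k"
    using p(1) degree_mult_le[of p "[:- real k, 1:]"] by simp
  moreover have "poly ?q x = x gchoose Suc k" for x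
    using gbinomial_mult_1[of x k] p(2)[of x] by (simp add: field_simps)
  ultimately show ?case by blast
qed

text \<open>At the least index \<open>k\<close> of nonzero weight the earlier weights are 0 and the
  later binomials vanish, so only \<open>w k\<close> survives.\<close>

lemma gchoose_combination_nonzero:
  fixes w :: "nat \<Rightarrow> real"
  assumes "k0 < K" "w k0 \<noteq> 0"
  shows "\<exists>x. (\<Sum>k<K. w k * (x gchoose k)) \<noteq> 0"
proof -
  define k where "k = (LEAST k. w k \<noteq> 0)"
  have wk: "w k \<noteq> 0" unfolding k_def by (rule LeastI) (rule assms(2))
  have kk: "k \<le> k0" unfolding k_def by (rule Least_le) (rule assms(2))
  have less: "w i = 0" if "i < k" for i
    using not_less_Least[of i "\<lambda>k. w k \<noteq> 0"] that unfolding k_def by simp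
  have "(\<Sum>i<K. w i * (real k gchoose i)) = (\<Sum>i\<in>{k}. w i * (real k gchoose i))"
  proof (rule sum.mono_neutral_right)
    show "\<forall>i\<in>{..<K} - {k}. w i * (real k gchoose i) = 0"
    proof
      fix i assume "i \<in> {..<K} - {k}"
      then consider "i < k" | "k < i" by fastforce
      then show "w i * (real k gchoose i) = 0"
      proof cases
        case 2
        then have "real k gchoose i = 0" unfolding binomial_gbinomial[symmetric] by simp
        then show ?thesis by simp
      qed (simp add: less)
    qed
  qed (use kk assms in auto)
  also have "\<dots> = w k" unfolding binomial_gbinomial[symmetric] by simp
  finally show ?thesis using wk by (intro exI[of _ "real k"]) simp
qed

lemma abs_exp_minus_one:
  assumes "\<bar>d :: real\<bar> \<le> 1 / 2"
  shows "\<bar>exp d - 1\<bar> \<le> 2 * \<bar>d\<bar>"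
proof -
  have "exp d \<le> exp \<bar>d\<bar>" by simp
  also have "\<dots> \<le> 1 + 2 * \<bar>d\<bar>" using exp_bound_lemma[of "\<bar>d\<bar>"] assms by simp
  finally have "exp d - 1 \<le> 2 * \<bar>d\<bar>" by simp
  moreover have "exp d \<ge> 1 + d" by (rule exp_ge_add_one_self)
  ultimately show ?thesis by linarith
qed

text \<open>The points are \<open>u = r z + s t\<close> with \<open>\<bar>r\<bar> \<le> R\<close>, \<open>\<bar>s\<bar> \<le> S\<close>, where \<open>exp (\<omega> u)\<close> is almost
  \<open>a\<^sup>r (c / a)\<^sup>s\<close>; the frequencies are \<open>l \<omega>\<close> with \<open>\<bar>l\<bar> \<le> M\<close>. The factor \<open>q\<close> in the proof clears the
  denominators separately for each \<open>l\<close>, so that the condition \<open>main\<close> only involves averages over \<open>l\<close> and \<open>k\<close>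
  of the logarithmic sizes; a common denominator would be too expensive.\<close>

lemma power_gap_contradiction:
  fixes a b c z t K M R S N L :: nat and \<rho> \<omega> W \<mu> Q :: real
  defines "L \<equiv> 2 * M + 1" and "N \<equiv> K * L"
    and "\<omega> \<equiv> ln a / z" and "W \<equiv> real R * z + real S * t" and "\<mu> \<equiv> (\<rho> * W + K) / K"
    and "Q \<equiv> \<omega> * \<rho> * W + (real R + real S) * ln a + real S * ln c"
  assumes a: "1 < a" "a < c" and pos: "0 < z" "0 < t" "0 < K" "0 < b" "0 < R" and cop: "coprime z t"
    and eq: "c ^ z = a ^ (z + t) + b"
    and \<rho>: "2 \<le> \<rho>"
    and size: "\<rho> ^ N * real b \<le> real a ^ (z + t)"
    and small: "M * S \<le> z" "2 * S < z" "M \<le> S"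
    and points: "L * (K - 1) < (2 * R + 1) * (2 * S + 1 - 2 * M)"
    and main: "(real K - 1) / 2 * ln \<mu> + real K + real M * (real M + 1) / real L * Q
                 + ln (24 * real N ^ 2) < (real N - 1) / 2 * ln \<rho>"
  shows False
proof -
  define I where "I = {..<K} \<times> {..<L}"
  have I: "finite I" "card I = N" by (auto simp: I_def N_def)
  have N: "N > 0" using pos by (simp add: N_def L_def)
  have la: "ln a > 0" and lc: "ln c > 0" using a by auto
  have \<omega>: "\<omega> > 0" and \<omega>z: "\<omega> * z = ln a" using la pos by (auto simp: \<omega>_def)
  have W: "W > 0" using pos by (simp add: W_def add_pos_nonneg)
  have \<mu>: "\<mu> > 0" using W \<rho> pos by (simp add: \<mu>_def add_pos_pos)
  define \<eta> where "\<eta> = real c / real a"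
  have \<eta>: "\<eta> > 1" using a by (simp add: \<eta>_def)
  have ln\<eta>: "ln \<eta> = ln c - ln a" using a by (simp add: \<eta>_def ln_div)
  define lv where "lv = (\<lambda>j. real j - real M)"
  have lvM: "\<bar>lv j\<bar> \<le> real M" if "j < L" for j using that by (auto simp: lv_def L_def)
  define lam where "lam = (\<lambda>j. nat \<bar>int j - int M\<bar>)"
  have lam: "real (lam j) = \<bar>lv j\<bar>" for j by (simp add: lam_def lv_def)
  \<comment> \<open>Since \<open>a^(l r) (c / a)^(l s) = a^(l (r - s)) c^(l s)\<close>, the
    exponents of \<open>a\<close> and \<open>c\<close> are at least
    \<open>- \<bar>l\<bar> (R + S)\<close> and \<open>- \<bar>l\<bar> S\<close>.\<close>
  define q where "q = (\<lambda>j. real a ^ (lam j * (R + S)) * real c ^ (lam j * S))"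
  have q: "q j > 0" for j using a by (simp add: q_def)
  have lnq: "ln (q j) = \<bar>lv j\<bar> * ((real R + real S) * ln a + real S * ln c)" for j
    using a by (simp add: q_def ln_mult ln_realpow algebra_simps flip: lam)
  define f where "f = (\<lambda>(k, j) u. q j * ((u gchoose k) * exp (lv j * \<omega> * u)))"
  define D where "D = (\<lambda>(k, j). q j * (\<mu> ^ k * exp K * exp (\<bar>lv j\<bar> * \<omega> * (\<rho> * W))))"
  have D: "D i > 0" for i using q \<mu> by (auto simp: D_def split: prod.splits)
  have rW: "\<rho> * W > 0" "W \<le> \<rho> * W" using W \<rho> by auto
  have maj: "majorized (\<rho> * W) (D i) (f i)" if i: "i \<in> I" for i
  proof -
    obtain k j where kj: "i = (k, j)" "k < K" "j < L" using i by (auto simp: I_def)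
    have "majorized (\<rho> * W) (\<bar>q j\<bar> * (((\<rho> * W + K) / K) ^ k * exp K * exp (\<bar>lv j * \<omega>\<bar> * (\<rho> * W))))
        (\<lambda>u. q j * ((u gchoose k) * exp (lv j * \<omega> * u)))"
      using rW kj pos by (intro majorized_cmult majorized_mult majorized_gbinomial' majorized_exp) auto
    then show ?thesis
      using q[of j] \<omega> kj by (simp add: D_def f_def \<mu>_def abs_mult)
  qed
  \<comment> \<open>Rescaling by \<open>W\<close> moves the interval that contains the evaluation
    points to \<open>[-1, 1]\<close>; \<open>\<rho>\<close> is the ratio of the majorization radius
    to its half-length.\<close>
  have "\<exists>e. (\<forall>j. \<bar>e j\<bar> \<le> D i / \<rho> ^ j) \<and> (\<forall>u. \<bar>u\<bar> \<le> 1 \<longrightarrow> (\<lambda>j. e j * u ^ j) sums f i (W * u))"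
    if i: "i \<in> I" for i
  proof -
    obtain e where e: "\<And>j. \<bar>e j\<bar> \<le> D i / (\<rho> * W) ^ j"
        "\<And>u. \<bar>u\<bar> \<le> \<rho> * W \<Longrightarrow> (\<lambda>j. e j * u ^ j) sums f i u"
      using majorized_coeffs[OF maj[OF i] rW(1)] by blast
    have "\<bar>e j * W ^ j\<bar> \<le> D i / \<rho> ^ j" for j
    proof -
      have "\<bar>e j * W ^ j\<bar> \<le> D i / (\<rho> * W) ^ j * W ^ j"
        using mult_right_mono[OF e(1)[of j], of "W ^ j"] W by (simp add: abs_mult)
      then show ?thesis using W by (simp add: power_mult_distrib)
    qed
    moreover have "(\<lambda>j. e j * W ^ j * u ^ j) sums f i (W * u)" if "\<bar>u\<bar> \<le> 1" for u
    proof -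
      have "\<bar>W * u\<bar> \<le> W" using that W by (simp add: abs_mult mult_left_le)
      then show ?thesis using e(2)[of "W * u"] rW(2) by (simp add: power_mult_distrib mult.assoc)
    qed
    ultimately show ?thesis by (intro exI[of _ "\<lambda>j. e j * W ^ j"]) auto
  qed
  then obtain e where e: "\<And>i j. i \<in> I \<Longrightarrow> \<bar>e i j\<bar> \<le> D i / \<rho> ^ j"
      "\<And>i u. i \<in> I \<Longrightarrow> \<bar>u\<bar> \<le> 1 \<Longrightarrow> (\<lambda>j. e i j * u ^ j) sums f i (W * u)"
    by metis
  define A where "A = (real K - 1) / 2 * ln \<mu> + real K + real M * (real M + 1) / real L * Q"
  have sumD: "(\<Sum>i\<in>I. ln (D i)) = real N * A"
  proof -
    have lnD: "ln (D (k, j)) = real k * ln \<mu> + real K + \<bar>lv j\<bar> * Q" for k j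
      using q[of j] \<mu> by (simp add: D_def ln_mult ln_realpow lnq Q_def algebra_simps)
    have sk: "(\<Sum>k<K. real k) = real K * (real K - 1) / 2"
      by (induction K) (auto simp: field_simps)
    have sl: "(\<Sum>j<L. \<bar>lv j\<bar>) = real M * (real M + 1)"
      unfolding lv_def L_def by (rule sum_abs_centred)
    have "(\<Sum>i\<in>I. ln (D i)) = (\<Sum>k<K. \<Sum>j<L. real k * ln \<mu> + real K + \<bar>lv j\<bar> * Q)"
      unfolding I_def lnD[symmetric] by (simp add: sum.cartesian_product)
    also have "\<dots> = (\<Sum>k<K. real L * (real k * ln \<mu> + real K) + real M * (real M + 1) * Q)"
      by (simp add: sum.distrib sl flip: sum_distrib_right)
    also have "\<dots> = real L * (real K * (real K - 1) / 2 * ln \<mu> + real K * real K) + real K * (real M * (real M + 1) * Q)"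
      by (simp add: sum.distrib sk flip: sum_distrib_right sum_distrib_left)
    also have "\<dots> = real N * A"
      by (simp add: N_def A_def L_def field_simps)
    finally show ?thesis .
  qed
  have "(\<Sum>i\<in>I. ln (D i)) + real N * ln (24 * real N ^ 2) < real N * (real N - 1) / 2 * ln \<rho>"
  proof -
    have "real N * (A + ln (24 * real N ^ 2)) < real N * ((real N - 1) / 2 * ln \<rho>)"
      using main N unfolding A_def by (intro mult_strict_left_mono) auto
    then show ?thesis unfolding sumD by (simp only: distrib_left times_divide_eq_right times_divide_eq_left mult.assoc)
  qed
  then have "\<exists>n :: nat \<times> nat \<Rightarrow> int. (\<exists>i\<in>I. n i \<noteq> (0 :: int)) \<and> (\<forall>i\<in>I. \<bar>real_of_int (n i)\<bar> * D i \<le> \<rho> ^ N / (8 * real N)) \<and>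
      (\<forall>u. \<bar>u\<bar> \<le> 1 \<longrightarrow> \<bar>\<Sum>i\<in>I. real_of_int (n i) * (\<Sum>j. e i j * u ^ j)\<bar> \<le> 1 / 2)"
    by (intro small_integer_combination[OF I N \<rho>]) (simp_all only: D e(1))
  then obtain n :: "nat \<times> nat \<Rightarrow> int" where n: "\<exists>i\<in>I. n i \<noteq> (0 :: int)"
      "\<forall>i\<in>I. \<bar>real_of_int (n i)\<bar> * D i \<le> \<rho> ^ N / (8 * real N)"
      "\<forall>u. \<bar>u\<bar> \<le> 1 \<longrightarrow> \<bar>\<Sum>i\<in>I. real_of_int (n i) * (\<Sum>j. e i j * u ^ j)\<bar> \<le> 1 / 2"
    by (elim exE conjE)
  define v where "v = (\<lambda>(r :: int) (s :: int). r * ln a + s * ln \<eta>)"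
  define x where "x = (\<lambda>(r :: int) (s :: int). r * int z + s * int t)"
  define F where "F = (\<lambda>r s. \<Sum>(k, j)\<in>I. n (k, j) * (q j * (of_int (x r s) gchoose k) * exp (lv j * v r s)))"
  have F0: "F r s = 0" if r: "\<bar>r\<bar> \<le> int R" and s: "\<bar>s\<bar> \<le> int S" for r s
  proof -
    have xW: "\<bar>real_of_int (x r s)\<bar> \<le> W"
    proof -
      have "\<bar>x r s\<bar> \<le> \<bar>r\<bar> * int z + \<bar>s\<bar> * int t"
        unfolding x_def by (rule order_trans[OF abs_triangle_ineq]) (simp add: abs_mult)
      also have "\<dots> \<le> int R * int z + int S * int t"
        using r s by (intro add_mono mult_right_mono) auto
      finally have "real_of_int \<bar>x r s\<bar> \<le> real_of_int (int R * int z + int S * int t)" by linarith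
      then show ?thesis by (simp add: W_def)
    qed
    let ?x = "real_of_int (x r s)"
    have "\<bar>\<Sum>i\<in>I. real_of_int (n i) * (\<Sum>j. e i j * (?x / W) ^ j)\<bar> \<le> 1 / 2"
      using n(3)[rule_format, of "?x / W"] xW W by simp
    moreover have "(\<Sum>j. e i j * (?x / W) ^ j) = f i ?x" if "i \<in> I" for i
      using e(2)[OF that, of "?x / W"] xW W by (simp add: sums_iff)
    ultimately have G: "\<bar>\<Sum>i\<in>I. real_of_int (n i) * f i ?x\<bar> \<le> 1 / 2" by simp
    \<comment> \<open>The linear form equals \<open>ln (1 + b / a^(z + t))\<close>, so
      \<open>size\<close> bounds it by \<open>1 / \<rho> ^ N\<close>. This cancels the factor
      \<open>\<rho> ^ N\<close> in the bound for the coefficients \<open>n i\<close>.\<close>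
    define \<Lambda> where "\<Lambda> = z * ln \<eta> - t * ln a"
    have bx: "real b / real a ^ (z + t) \<le> 1 / \<rho> ^ N"
      using size a \<rho> by (simp add: field_simps)
    have \<Lambda>: "0 \<le> \<Lambda>" "\<Lambda> \<le> 1 / \<rho> ^ N"
    proof -
      have "real c ^ z = real a ^ (z + t) + real b"
        using arg_cong[OF eq, of real] by simp
      then have "real c ^ z / real a ^ (z + t) = 1 + real b / real a ^ (z + t)"
        using a by (simp add: field_simps)
      moreover have "ln (real c ^ z / real a ^ (z + t)) = \<Lambda>"
        using a by (simp add: \<Lambda>_def ln\<eta> ln_div ln_realpow algebra_simps)
      ultimately have *: "\<Lambda> = ln (1 + real b / real a ^ (z + t))" by simp
      show "0 \<le> \<Lambda>" unfolding * by simp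
      have "\<Lambda> \<le> real b / real a ^ (z + t)" unfolding * by (rule ln_add_one_self_le_self) simp
      then show "\<Lambda> \<le> 1 / \<rho> ^ N" using bx by simp
    qed
    have \<rho>N: "1 / \<rho> ^ N \<le> 1 / 2"
    proof -
      have "2 ^ 1 \<le> (2 :: real) ^ N" using N by (intro power_increasing) auto
      also have "\<dots> \<le> \<rho> ^ N" using \<rho> by (intro power_mono) auto
      finally show ?thesis using \<rho> by (simp add: field_simps)
    qed
    \<comment> \<open>The exact exponent and its value at the evaluation point differ by a multiple
      of \<open>\<Lambda> / z\<close>, and \<open>M * S \<le> z\<close> keeps this difference below
      \<open>\<Lambda>\<close>.\<close>
    have diff: "lv j * v r s - lv j * \<omega> * ?x = lv j * s * (\<Lambda> / z)" for j
    proof -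
      have "\<omega> * ?x = r * ln a + s * (\<omega> * t)"
        unfolding x_def using \<omega>z by (simp add: algebra_simps)
      moreover have "\<omega> * t = ln \<eta> - \<Lambda> / z" using pos by (simp add: \<omega>_def \<Lambda>_def field_simps)
      ultimately have "\<omega> * ?x = v r s - s * (\<Lambda> / z)" by (simp add: v_def algebra_simps)
      then show ?thesis
        unfolding mult.assoc[of "lv j" \<omega>] by (simp only: right_diff_distrib mult.assoc)
    qed
    have diff_le: "\<bar>lv j * s * (\<Lambda> / z)\<bar> \<le> \<Lambda>" if "j < L" for j
    proof -
      have "\<bar>lv j * s\<bar> \<le> real M * real S"
        unfolding abs_mult using lvM[OF that] s by (intro mult_mono) auto
      also have "\<dots> \<le> real z" using small(1) by (metis of_nat_le_iff of_nat_mult)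
      finally have "\<bar>lv j * s\<bar> * (\<Lambda> / z) \<le> real z * (\<Lambda> / z)"
        using \<Lambda>(1) by (intro mult_right_mono) auto
      moreover have "\<bar>lv j * s * (\<Lambda> / z)\<bar> = \<bar>lv j * s\<bar> * (\<Lambda> / z)"
        using \<Lambda>(1) by (simp add: abs_mult)
      ultimately show ?thesis using pos(1) by simp
    qed
    have term_le: "\<bar>n (k, j) * (q j * (?x gchoose k) * exp (lv j * v r s)) - n (k, j) * f (k, j) ?x\<bar>
        \<le> \<rho> ^ N / (8 * real N) * (2 * \<Lambda>)" if kj: "(k, j) \<in> I" for k j
    proof -
      let ?d = "lv j * s * (\<Lambda> / z)"
      have j: "j < L" using kj by (simp add: I_def)
      have "exp (lv j * v r s) = exp (lv j * \<omega> * ?x) * exp ?d"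
        unfolding diff[of j, symmetric] by (simp flip: exp_add)
      then have "n (k, j) * (q j * (?x gchoose k) * exp (lv j * v r s)) - n (k, j) * f (k, j) ?x
          = n (k, j) * f (k, j) ?x * (exp ?d - 1)"
        by (simp add: f_def algebra_simps)
      moreover have "\<bar>n (k, j) * f (k, j) ?x\<bar> \<le> \<rho> ^ N / (8 * real N)"
      proof -
        have "\<bar>f (k, j) ?x\<bar> \<le> D (k, j)"
          using xW rW by (intro majorized_bound[OF maj[OF kj]]) auto
        then have "\<bar>real_of_int (n (k, j))\<bar> * \<bar>f (k, j) ?x\<bar> \<le> \<bar>real_of_int (n (k, j))\<bar> * D (k, j)"
          by (intro mult_left_mono) auto
        then show ?thesis using bspec[OF n(2) kj] by (simp add: abs_mult)
      qed
      moreover have "\<bar>exp ?d - 1\<bar> \<le> 2 * \<Lambda>"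
        using abs_exp_minus_one[of ?d] diff_le[OF j] \<Lambda> \<rho>N by linarith
      ultimately show ?thesis by (simp only: abs_mult) (intro mult_mono, use \<rho> in auto)
    qed
    \<comment> \<open>The \<open>N\<close> errors add up to at most
      \<open>\<rho> ^ N * \<Lambda> / 4 \<le> 1/4\<close>; with the 1/2 from the pigeonhole step,
      \<open>F r s\<close> stays below 1 in absolute value.\<close>
    have "\<bar>F r s - (\<Sum>i\<in>I. real_of_int (n i) * f i ?x)\<bar> \<le> (\<Sum>i\<in>I. \<rho> ^ N / (8 * real N) * (2 * \<Lambda>))"
      unfolding F_def sum_subtractf[symmetric]
    proof (rule order_trans[OF sum_abs], rule sum_mono)
      fix i assume i: "i \<in> I"
      obtain k j where kj: "i = (k, j)" by fastforce
      show "\<bar>(case i of (k, j) \<Rightarrow> real_of_int (n (k, j)) * (q j * (?x gchoose k) * exp (lv j * v r s)))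
          - real_of_int (n i) * f i ?x\<bar> \<le> \<rho> ^ N / (8 * real N) * (2 * \<Lambda>)"
        using term_le[OF i[unfolded kj]] unfolding kj prod.case .
    qed
    also have "\<dots> = \<rho> ^ N * \<Lambda> / 4" using I N by simp
    also have "\<dots> \<le> 1 / 4" using \<Lambda>(2) \<rho> by (simp add: field_simps)
    finally have "\<bar>F r s\<bar> < 1" using G by linarith
    moreover have "F r s \<in> \<int>"
      unfolding F_def
    proof (intro Ints_sum, clarify)
      fix k j
      let ?l = "int j - int M"
      have xk: "(?x gchoose k) \<in> \<int>"
        unfolding of_int_gbinomial[symmetric] by (rule Ints_of_int)
      have "q j * exp (lv j * v r s) = real a ^ nat (\<bar>?l\<bar> * (int R + int S) + ?l * (r - s)) * real c ^ nat (\<bar>?l\<bar> * int S + ?l * s)"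
      proof -
        have n1: "0 \<le> \<bar>?l\<bar> * (int R + int S) + ?l * (r - s)"
        proof -
          have "\<bar>?l * (r - s)\<bar> \<le> \<bar>?l\<bar> * (int R + int S)"
            unfolding abs_mult using r s by (intro mult_left_mono) auto
          then show ?thesis by linarith
        qed
        have n2: "0 \<le> \<bar>?l\<bar> * int S + ?l * s"
        proof -
          have "\<bar>?l * s\<bar> \<le> \<bar>?l\<bar> * int S"
            unfolding abs_mult using s by (intro mult_left_mono) auto
          then show ?thesis by linarith
        qed
        have pw: "real y ^ nat w = exp (w * ln y)" if "0 \<le> w" "0 < y" for y :: nat and w
        proof -
          have "exp (w * ln y) = exp (real (nat w) * ln y)" using that(1) by simp
          also have "\<dots> = real y ^ nat w" unfolding exp_of_nat_mult using that(2) by simp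
          finally show ?thesis ..
        qed
        have "q j = exp (ln (q j))" using q[of j] by simp
        then have "q j * exp (lv j * v r s) = exp (ln (q j) + lv j * v r s)" by (simp add: exp_add)
        also have "ln (q j) + lv j * v r s = real_of_int (\<bar>?l\<bar> * (int R + int S) + ?l * (r - s)) * ln a
            + real_of_int (\<bar>?l\<bar> * int S + ?l * s) * ln c"
          unfolding lnq v_def ln\<eta> lv_def by (simp add: algebra_simps)
        also have "exp \<dots> = real a ^ nat (\<bar>?l\<bar> * (int R + int S) + ?l * (r - s)) * real c ^ nat (\<bar>?l\<bar> * int S + ?l * s)"
          unfolding exp_add using pw[OF n1] pw[OF n2] a by simp
        finally show ?thesis .
      qed
      then have "q j * exp (lv j * v r s) \<in> \<int>" by simp
      then have "real_of_int (n (k, j)) * ((?x gchoose k) * (q j * exp (lv j * v r s))) \<in> \<int>"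
        by (rule Ints_mult[OF Ints_of_int Ints_mult[OF xk]])
      then show "real_of_int (n (k, j)) * (q j * (?x gchoose k) * exp (lv j * v r s)) \<in> \<int>"
        by (simp add: ac_simps)
    qed
    ultimately show ?thesis using Ints_nonzero_abs_less1 by blast
  qed
  obtain B :: "nat \<Rightarrow> real poly" where B: "\<And>k. degree (B k) \<le> k" "\<And>k x. poly (B k) x = x gchoose k"
    using exists_gchoose_poly by metis
  define P where "P = (\<lambda>j. smult (q j) (\<Sum>k<K. smult (n (k, j)) (B k)))"
  have polyP: "poly (P j) y = q j * (\<Sum>k<K. n (k, j) * (y gchoose k))" for j y
    by (simp add: P_def poly_sum B)
  have degP: "degree (P j) \<le> K - 1" for j
  proof -
    have "degree (\<Sum>k<K. smult (n (k, j)) (B k)) \<le> K - 1"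
      using B(1) by (intro degree_sum_le) (auto intro: order_trans[OF degree_smult_le] order_trans[OF B(1)])
    then show ?thesis unfolding P_def by (rule order_trans[OF degree_smult_le])
  qed
  have nzP: "\<exists>j<L. P j \<noteq> 0"
  proof -
    obtain k j where kj: "k < K" "j < L" "n (k, j) \<noteq> 0" using n(1) by (auto simp: I_def)
    obtain y where "(\<Sum>k<K. n (k, j) * (y gchoose k)) \<noteq> 0"
      using gchoose_combination_nonzero[of k K "\<lambda>k. n (k, j)"] kj by auto
    then have "poly (P j) y \<noteq> 0" using polyP q[of j] by auto
    then show ?thesis using kj(2) by (metis poly_0)
  qed
  \<comment> \<open>The zero estimate shifts \<open>s\<close> by up to \<open>L - 1 = 2 M\<close>;
    stopping at \<open>S - 2 M\<close> keeps all shifted points in the range of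
    \<open>F0\<close>.\<close>
  define E where "E = {- int R..int R} \<times> {- int S..int S - 2 * int M}"
  \<comment> \<open>Equal points give \<open>(r - r') z = (s' - s) t\<close>; by coprimality
    \<open>z\<close> divides \<open>s' - s\<close>, whose absolute value is at most
    \<open>2 S < z\<close>.\<close>
  have injx: "inj_on (\<lambda>(r, s). real_of_int (x r s)) E"
  proof (rule inj_onI, clarify)
    fix r s r' s' assume rs: "(r, s) \<in> E" "(r', s') \<in> E" and "real_of_int (x r s) = real_of_int (x r' s')"
    then have "x r s = x r' s'" by (simp only: of_int_eq_iff)
    then have xx: "(r - r') * int z = (s' - s) * int t" unfolding x_def by (simp add: algebra_simps)
    then have "int z dvd (s' - s) * int t" by (metis dvd_triv_right)
    then have "int z dvd s' - s" using cop by (simp add: coprime_dvd_mult_left_iff)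
    moreover have "\<bar>s' - s\<bar> < int z" using rs small(2) by (auto simp: E_def)
    ultimately have "s' = s" using zdvd_not_zless[of "\<bar>s' - s\<bar>" "int z"] by (metis dvd_abs_iff abs_ge_zero abs_0_eq eq_iff_diff_eq_0 less_le)
    then show "r = r' \<and> s = s'" using xx pos by simp
  qed
  show False
  proof (rule zero_estimate[of \<eta> L P "K - 1" "(\<lambda>(r, s). real_of_int (x r s)) ` E" "real t"])
    show "finite ((\<lambda>(r, s). real_of_int (x r s)) ` E)" by (simp add: E_def)
    have "card ((\<lambda>(r, s). real_of_int (x r s)) ` E) = card E" by (rule card_image[OF injx])
    also have "\<dots> = (2 * R + 1) * (2 * S + 1 - 2 * M)"
    proof -
      have "card {- int R..int R} = 2 * R + 1" by simp
      moreover have "card {- int S..int S - 2 * int M} = 2 * S + 1 - 2 * M"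
        using small(3) by simp
      ultimately show ?thesis unfolding E_def card_cartesian_product by simp
    qed
    finally show "L * (K - 1) < card ((\<lambda>(r, s). real_of_int (x r s)) ` E)" using points by simp
  next
    fix w assume "w \<in> (\<lambda>(r, s). real_of_int (x r s)) ` E"
    then obtain r s where rs: "w = real_of_int (x r s)" "\<bar>r\<bar> \<le> int R" "- int S \<le> s" "s \<le> int S - 2 * int M"
      by (auto simp: E_def)
    have "(\<Sum>l<L. poly (P l) (w + real \<sigma> * real t) * (exp (v r s) * \<eta> ^ \<sigma>) ^ l) = 0" if \<sigma>: "\<sigma> < L" for \<sigma>
    proof -
      let ?s = "s + int \<sigma>"
      have w: "w + real \<sigma> * real t = real_of_int (x r ?s)" by (simp add: rs x_def algebra_simps)
      have y: "exp (v r s) * \<eta> ^ \<sigma> = exp (v r ?s)"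
        using \<eta> by (simp add: v_def algebra_simps exp_add exp_of_nat_mult)
      \<comment> \<open>Frequencies are centred at 0 while the powers in
        \<open>zero_estimate\<close> start at 0; the factor \<open>exp (M * v r ?s)\<close> converts
        between them and does not affect vanishing.\<close>
      have yl: "exp (v r ?s) ^ l = exp (M * v r ?s) * exp (lv l * v r ?s)" for l
        by (simp add: lv_def algebra_simps flip: exp_of_nat_mult exp_add)
      have "(\<Sum>l<L. poly (P l) (w + real \<sigma> * real t) * (exp (v r s) * \<eta> ^ \<sigma>) ^ l)
          = (\<Sum>l<L. \<Sum>k<K. exp (M * v r ?s) * (n (k, l) * (q l * (real_of_int (x r ?s) gchoose k) * exp (lv l * v r ?s))))"
        unfolding y w polyP yl sum_distrib_left sum_distrib_right
        by (intro sum.cong) (auto simp: ac_simps)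
      also have "\<dots> = exp (M * v r ?s) * F r ?s"
        unfolding F_def I_def sum.cartesian_product[symmetric] by (subst sum.swap) (simp add: sum_distrib_left)
      also have "F r ?s = 0" using rs \<sigma> by (intro F0) (auto simp: L_def)
      finally show ?thesis by simp
    qed
    then show "\<exists>y. y \<noteq> 0 \<and> (\<forall>\<sigma><L. (\<Sum>l<L. poly (P l) (w + real \<sigma> * real t) * (y * \<eta> ^ \<sigma>) ^ l) = 0)"
      by (intro exI[of _ "exp (v r s)"]) auto
  qed (use \<eta> degP nzP in auto)
qed

text \<open>Parameters for \<open>power_gap_contradiction\<close> with \<open>M = 3\<close>, so
  seven frequencies. Comparing logarithms in \<open>eq\<close> gives \<open>t h \<le> z d\<close>,
  and \<open>t \<ge> 3\<close> then makes \<open>z / h\<close> at least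
  \<open>3 / 0.00212 > 1400\<close>. How far \<open>z\<close> exceeds \<open>1400 h\<close> is
  measured by \<open>\<theta>\<close>.\<close>

lemma power_gap_impossible:
  fixes a b c z t :: nat
  assumes a: "405 \<le> a" "a < c" "real c \<le> (100212 / 100000) * real a" and b: "0 < b" "b \<le> a"
    and t: "3 \<le> t" "coprime z t" and eq: "c ^ z = a ^ (z + t) + b"
  shows False
proof -
  define h where "h = ln (real a)"
  define d :: real where "d = (212 / 100000)"
  have e: "exp 1 < ((272 / 100) :: real)" using e_less_272 by simp
  \<comment> \<open>405 is the least integer above \<open>2.72 ^ 6\<close>.\<close>
  have h: "6 \<le> h"
  proof -
    have "exp 6 = exp (1 :: real) ^ 6" by (simp flip: exp_of_nat_mult)
    also have "\<dots> \<le> (272 / 100) ^ 6" using e by (intro power_mono) auto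
    also have "\<dots> \<le> real a" using a(1) by (simp add: power_divide)
    finally show ?thesis unfolding h_def using a(1) by (subst ln_ge_iff) auto
  qed
  have lc: "ln (real c) \<le> h + d"
  proof -
    have "real c \<le> real a * exp d"
    proof -
      have "(100212 / 100000) \<le> exp d" using exp_ge_add_one_self[of d] by (simp add: d_def)
      then have "real a * (100212 / 100000) \<le> real a * exp d" by (rule mult_left_mono) simp
      then show ?thesis using a(3) by simp
    qed
    then have "ln (real c) \<le> ln (real a * exp d)" using a by simp
    also have "\<dots> = h + d" using a by (simp add: ln_mult h_def)
    finally show ?thesis .
  qed
  have tz: "real t * h \<le> real z * d"
  proof -
    have "real a ^ (z + t) \<le> real c ^ z"
      using arg_cong[OF eq, of real] by simp
    then have "ln (real a ^ (z + t)) \<le> ln (real c ^ z)" using a by simp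
    then have "(real z + real t) * h \<le> real z * ln (real c)"
      using a by (simp add: ln_realpow h_def)
    also have "\<dots> \<le> real z * (h + d)" using lc by (intro mult_left_mono) auto
    finally show ?thesis by (simp add: algebra_simps)
  qed
  have z: "1400 * h \<le> real z"
  proof -
    have "3 * h \<le> real t * h" using t h by (intro mult_right_mono) auto
    then have "3 * h \<le> real z * d" using tz by simp
    then show ?thesis using h by (simp add: d_def)
  qed
  define \<theta> where "\<theta> = root 4 (real z / (1400 * h))"
  have \<theta>4: "real z = 1400 * h * \<theta> ^ 4"
    using z h by (simp add: \<theta>_def)
  have \<theta>: "1 \<le> \<theta>" unfolding \<theta>_def using z h by simp
  define g where "g = \<theta> * h"
  have g: "h \<le> g" "6 \<le> g" using mult_right_mono[OF \<theta>, of h] h unfolding g_def by linarith+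
  have gg: "6 * g \<le> g ^ 2" "36 \<le> g ^ 2"
    using g mult_mono[of 6 g 6 g] by (auto simp: power2_eq_square)
  \<comment> \<open>With \<open>z = 1400 h \<theta>\<^sup>4\<close> and \<open>g = \<theta> h\<close>, all terms of the main inequality are of order \<open>g\<^sup>2\<close>, and the
    leading constants below leave a margin of about ten percent at \<open>\<theta> = 1\<close>. Letting \<open>\<rho>\<close> grow with \<open>\<theta>\<close>
    compensates the term \<open>4 ln \<theta>\<close> in \<open>ln \<mu>\<close>.\<close>
  define \<rho> where "\<rho> = exp (5 / 2) * \<theta>"
  define K where "K = nat \<lfloor>60 * g ^ 2\<rfloor>"
  define R where "R = nat \<lceil>4 * g\<rceil>"
  \<comment> \<open>The point count asks for \<open>(2 R + 1) (2 S - 5) > 7 (K - 1)\<close>, and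
    \<open>8 * 52.5 = 7 * 60\<close> balances the constants. The extra 3 is \<open>M\<close>: it
    restores the \<open>2 M\<close> values of \<open>s\<close> lost to the shifts.\<close>
  define S where "S = nat \<lceil>(2625 / 100) * g\<rceil> + 3"
  have K: "60 * g ^ 2 - 1 < real K" "real K \<le> 60 * g ^ 2"
    unfolding K_def by (simp_all add: of_nat_nat)
  have R: "4 * g \<le> real R" "real R \<le> 4 * g + 1"
    unfolding R_def using g by (simp_all add: of_nat_nat)
  have S: "(2625 / 100) * g + 3 \<le> real S" "real S \<le> (2625 / 100) * g + 4"
    unfolding S_def using g by (simp_all add: of_nat_nat) linarith+
  have Kg: "(5997 / 100) * g ^ 2 \<le> real K" using K gg by linarith
  have K0: "0 < K" using Kg gg by (cases "K = 0") auto
  have e52: "exp (5 / 2) \<le> ((1221 / 100) :: real)"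
  proof (rule power2_le_imp_le)
    have "exp (5 / 2) ^ 2 = exp (1 :: real) ^ 5" by (simp flip: exp_of_nat_mult)
    also have "\<dots> \<le> (272 / 100) ^ 5" using e by (intro power_mono) auto
    also have "\<dots> \<le> (1221 / 100) ^ 2" by (simp add: power_divide)
    finally show "exp (5 / 2) ^ 2 \<le> ((1221 / 100) :: real) ^ 2" .
  qed simp
  have \<rho>: "\<rho> \<le> (1221 / 100) * \<theta>" "0 < \<rho>" "2 \<le> \<rho>" "ln \<rho> = 5 / 2 + ln \<theta>"
  proof -
    show "\<rho> \<le> (1221 / 100) * \<theta>" unfolding \<rho>_def using e52 \<theta> by (intro mult_right_mono) auto
    show "0 < \<rho>" using \<theta> by (simp add: \<rho>_def)
    have "2 * 1 \<le> exp (5 / 2) * \<theta>"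
      using exp_ge_add_one_self[of "5 / 2"] \<theta> by (intro mult_mono) auto
    then show "2 \<le> \<rho>" by (simp add: \<rho>_def)
    show "ln \<rho> = 5 / 2 + ln \<theta>" using \<theta> by (simp add: \<rho>_def ln_mult)
  qed
  have ln\<theta>: "0 \<le> ln \<theta>" "ln \<theta> \<le> \<theta> ^ 2 - 1"
  proof -
    show "0 \<le> ln \<theta>" using \<theta> by simp
    have "ln \<theta> \<le> \<theta> - 1" using \<theta> by (intro ln_le_minus_one) auto
    also have "\<dots> \<le> \<theta> ^ 2 - 1" using \<theta> mult_left_mono[of 1 \<theta> \<theta>] by (simp add: power2_eq_square)
    finally show "ln \<theta> \<le> \<theta> ^ 2 - 1" .
  qed
  define W where "W = real R * z + real S * t"
  have zpos: "0 < real z" using z h by linarith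
  \<comment> \<open>As \<open>t \<le> z d / h\<close>, the part \<open>S t\<close> is tiny beside
    \<open>R z\<close>; rounding \<open>R\<close> up costs at most 1, hence at most
    \<open>g / 6\<close>.\<close>
  have W: "W \<le> (418 / 100) * g * z" "0 \<le> W"
  proof -
    have "real S * t \<le> real S * (real z * d / h)"
      using tz h by (intro mult_left_mono) (auto simp: field_simps)
    also have "\<dots> \<le> real S * (real z * d / 6)"
      using h by (intro mult_left_mono divide_left_mono) (auto simp: d_def)
    finally have "W \<le> (real R + real S * d / 6) * z"
      unfolding W_def by (simp add: algebra_simps)
    also have "\<dots> \<le> ((418 / 100) * g) * z"
      using R S g by (intro mult_right_mono) (auto simp: d_def)
    finally show "W \<le> (418 / 100) * g * z" .
  qed (simp add: W_def)
  have \<rho>W: "\<rho> * W \<le> (5104 / 100) * \<theta> * g * z" "0 \<le> \<rho> * W"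
  proof -
    have "\<rho> * W \<le> ((1221 / 100) * \<theta>) * ((418 / 100) * g * z)"
      using \<rho> W \<theta> by (intro mult_mono) auto
    also have "\<dots> \<le> (5104 / 100) * (\<theta> * g * z)" using \<theta> g by simp
    finally show "\<rho> * W \<le> (5104 / 100) * \<theta> * g * z" by (simp add: ac_simps)
  qed (use \<rho> W in auto)
  define \<mu> where "\<mu> = (\<rho> * W + K) / K"
  \<comment> \<open>Here \<open>71456 = 51.04 * 1400\<close> and
    \<open>71456 / 59.97 < 1199\<close>; the summand 1 of \<open>\<mu>\<close> is absorbed by
    \<open>\<theta> ^ 4 \<ge> 1\<close>.\<close>
  have \<mu>: "1 \<le> \<mu>" "\<mu> \<le> 1200 * \<theta> ^ 4"
  proof -
    have "\<theta> * g * z = 1400 * \<theta> ^ 4 * g ^ 2"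
      unfolding \<theta>4 by (simp add: g_def power2_eq_square ac_simps)
    then have "\<rho> * W \<le> 71456 * \<theta> ^ 4 * g ^ 2" using \<rho>W(1) by (simp add: ac_simps)
    also have "\<dots> \<le> 1199 * \<theta> ^ 4 * ((5997 / 100) * g ^ 2)" using \<theta> by simp
    also have "\<dots> \<le> 1199 * \<theta> ^ 4 * K" using Kg \<theta> by (intro mult_left_mono) auto
    finally have "\<mu> \<le> 1199 * \<theta> ^ 4 + 1" using K0 by (simp add: \<mu>_def field_simps)
    moreover have "1 \<le> \<theta> ^ 4" using \<theta> by (rule one_le_power)
    ultimately show "\<mu> \<le> 1200 * \<theta> ^ 4" by linarith
    show "1 \<le> \<mu>" using \<rho>W K0 by (simp add: \<mu>_def field_simps)
  qed
  have ln\<mu>: "0 \<le> ln \<mu>" "ln \<mu> \<le> (72 / 10) + 4 * ln \<theta>"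
  proof -
    show "0 \<le> ln \<mu>" using \<mu> by simp
    have "1200 \<le> ((1105 / 1000) :: real) ^ 72" by (simp add: power_divide)
    also have "\<dots> \<le> exp (1 / 10) ^ 72"
      using exp_lower_Taylor_quadratic[of "(1 / 10)"] by (intro power_mono) (auto simp: power2_eq_square)
    also have "\<dots> = exp (72 / 10)" by (simp flip: exp_of_nat_mult)
    finally have "ln 1200 \<le> ln (exp ((72 / 10) :: real))" by (subst ln_le_cancel_iff) auto
    then have "ln 1200 \<le> (72 / 10 :: real)" by simp
    moreover have "ln \<mu> \<le> ln (1200 * \<theta> ^ 4)" using \<mu> \<theta> by (subst ln_le_cancel_iff) auto
    moreover have "ln (1200 * \<theta> ^ 4) = ln 1200 + 4 * ln \<theta>"
      using \<theta> by (simp add: ln_mult ln_realpow)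
    ultimately show "ln \<mu> \<le> (72 / 10) + 4 * ln \<theta>" by simp
  qed
  define Q where "Q = ln (real a) / z * \<rho> * W + (real R + real S) * ln (real a) + real S * ln (real c)"
  have Q: "Q \<le> 110 * g ^ 2"
  proof -
    have "ln (real a) / z * \<rho> * W = h / z * (\<rho> * W)" by (simp add: h_def)
    also have "\<dots> \<le> h / z * ((5104 / 100) * \<theta> * g * z)" using \<rho>W h by (intro mult_left_mono) auto
    also have "\<dots> = (5104 / 100) * g ^ 2" using zpos by (simp add: g_def power2_eq_square)
    finally have 1: "ln (real a) / z * \<rho> * W \<le> (5104 / 100) * g ^ 2" .
    have "real R * h \<le> (4 * g + 1) * g" using R h g by (intro mult_mono) auto
    then have 2: "real R * h \<le> 4 * g ^ 2 + g" by (simp add: power2_eq_square algebra_simps)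
    have "real S * h + real S * ln (real c) \<le> real S * (2 * h + d)"
      using mult_left_mono[OF lc, of "real S"] by (simp add: algebra_simps)
    also have "\<dots> \<le> ((2625 / 100) * g + 4) * (2 * g + d)"
      using S h g by (intro mult_mono) (auto simp: d_def)
    also have "\<dots> = (525 / 10) * g ^ 2 + 8 * g + d * ((2625 / 100) * g + 4)"
      by (simp add: power2_eq_square algebra_simps)
    also have "d * ((2625 / 100) * g + 4) \<le> g"
      using g by (simp add: d_def)
    finally have 3: "real S * h + real S * ln (real c) \<le> (525 / 10) * g ^ 2 + 9 * g"
      by simp
    show ?thesis unfolding Q_def using 1 2 3 gg by (simp add: algebra_simps flip: h_def)
  qed
  define N where "N = K * 7"
  have N: "real N \<le> 420 * g ^ 2" "420 * g ^ 2 - 7 \<le> real N" "1 \<le> real N"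
    using K K0 unfolding N_def by simp_all
  have gt0: "0 < g ^ 2" using gg by linarith
  have g\<theta>: "0 \<le> g ^ 2 * ln \<theta>" using ln\<theta> gt0 by simp
  \<comment> \<open>The factor 12/7 is \<open>M (M + 1) / L\<close>. In units of
    \<open>g ^ 2\<close> the left side is at most \<open>216 + 60 + 188.6 + 20 = 484.6\<close> and
    the right side at least 523.75; the multiples of \<open>g ^ 2 * ln \<theta>\<close> are 120 and
    209.5.\<close>
  have main: "(real K - 1) / 2 * ln \<mu> + real K + 12 / 7 * Q + ln (24 * real N ^ 2) < (real N - 1) / 2 * ln \<rho>"
  proof -
    have "(real K - 1) / 2 * ln \<mu> \<le> (30 * g ^ 2) * ((72 / 10) + 4 * ln \<theta>)"
      using K ln\<mu> K0 gt0 by (intro mult_mono) auto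
    then have 1: "(real K - 1) / 2 * ln \<mu> \<le> 216 * g ^ 2 + 120 * (g ^ 2 * ln \<theta>)"
      by (simp add: algebra_simps)
    have 2: "ln (24 * real N ^ 2) \<le> 20 * g ^ 2"
    proof -
      have "24 * real N ^ 2 \<le> (5 * real N) ^ 2" by (simp add: power2_eq_square)
      then have "ln (24 * real N ^ 2) \<le> ln ((5 * real N) ^ 2)" using N by simp
      also have "\<dots> = 2 * ln (5 * real N)" using N ln_realpow[of "5 * real N" 2] by simp
      also have "ln (5 * real N) \<le> ln (2100 * g ^ 2)" using N gt0 by (subst ln_le_cancel_iff) auto
      also have "ln (2100 * g ^ 2) = ln 2100 + 2 * ln g" using g by (simp add: ln_mult ln_realpow)
      also have "ln 2100 \<le> (21 :: real)"
      proof -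
        have "2100 \<le> (2 :: real) ^ 21" by simp
        also have "\<dots> \<le> exp 1 ^ 21" using exp_ge_add_one_self[of 1] by (intro power_mono) auto
        also have "\<dots> = exp 21" by (simp flip: exp_of_nat_mult)
        finally have "ln 2100 \<le> ln (exp (21 :: real))" by (subst ln_le_cancel_iff) auto
        then show ?thesis by simp
      qed
      also have "ln g \<le> g" using g by (intro ln_bound) auto
      finally show ?thesis using gg g by simp
    qed
    have "(420 * g ^ 2 - 8) / 2 * (5 / 2 + ln \<theta>) \<le> (real N - 1) / 2 * ln \<rho>"
      unfolding \<rho>(4) using N ln\<theta> gg by (intro mult_mono) auto
    moreover have "(420 * g ^ 2 - 8) / 2 * (5 / 2 + ln \<theta>) \<ge> (419 * g ^ 2) / 2 * (5 / 2 + ln \<theta>)"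
      using gg ln\<theta> by (intro mult_right_mono) auto
    moreover have "(419 * g ^ 2) / 2 * (5 / 2 + ln \<theta>) = (52375 / 100) * g ^ 2 + (2095 / 10) * (g ^ 2 * ln \<theta>)"
      by (simp add: algebra_simps)
    ultimately have 3: "(52375 / 100) * g ^ 2 + (2095 / 10) * (g ^ 2 * ln \<theta>) \<le> (real N - 1) / 2 * ln \<rho>"
      by linarith
    show ?thesis using 1 2 3 Q K g\<theta> gt0 by linarith
  qed
  \<comment> \<open>In units of \<open>\<theta> ^ 2 * g ^ 2\<close>, \<open>N ln \<rho>\<close> is
    at most \<open>420 * 5/2 = 1050\<close>, while \<open>z h\<close> is 1400. The factor
    \<open>b\<close> is paid for by \<open>a ^ t\<close>.\<close>
  have size: "\<rho> ^ N * real b \<le> real a ^ (z + t)"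
  proof -
    have "5 / 2 + ln \<theta> \<le> 5 / 2 * \<theta> ^ 2"
      using ln\<theta> one_le_power[OF \<theta>, of 2] by linarith
    then have "real N * ln \<rho> \<le> (420 * g ^ 2) * (5 / 2 * \<theta> ^ 2)"
      unfolding \<rho>(4) using N ln\<theta> by (intro mult_mono) auto
    also have "\<dots> \<le> 1400 * \<theta> ^ 2 * g ^ 2" using gt0 \<theta> by simp
    also have "\<dots> = real z * h" unfolding \<theta>4 by (simp add: g_def power2_eq_square power4_eq_xxxx ac_simps)
    finally have "real N * ln \<rho> \<le> real z * h" .
    moreover have "ln (real b) \<le> real t * h"
    proof -
      have "ln (real b) \<le> h" unfolding h_def using b a by simp
      also have "\<dots> \<le> real t * h" using t h mult_right_mono[of 1 "real t" h] by simp
      finally show ?thesis .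
    qed
    ultimately have "ln (\<rho> ^ N * real b) \<le> ln (real a ^ (z + t))"
      using \<rho> b a by (simp add: ln_mult ln_realpow distrib_right flip: h_def)
    then show ?thesis using \<rho> b a by simp
  qed
  have zS: "3 * S \<le> z" "2 * S < z"
  proof -
    have "\<theta> \<le> \<theta> ^ 4" using \<theta> by (rule self_le_power) simp
    then have "h * \<theta> \<le> h * \<theta> ^ 4" using h by (intro mult_left_mono) auto
    then have "1400 * g \<le> real z" unfolding \<theta>4 g_def by (simp add: mult.commute)
    then have "real (3 * S) < real z" using S g by simp
    then show "3 * S \<le> z" "2 * S < z" by linarith+
  qed
  have points: "7 * (K - 1) < (2 * R + 1) * (2 * S + 1 - 2 * 3)"
  proof -
    have "real (7 * (K - 1)) < 420 * g ^ 2" using K K0 by (simp add: of_nat_diff)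
    also have "\<dots> = (8 * g) * ((525 / 10) * g)" by (simp add: power2_eq_square)
    also have "\<dots> \<le> real (2 * R + 1) * (2 * real S - 5)"
      using R S g by (intro mult_mono) auto
    also have "2 * real S - 5 = real (2 * S + 1 - 2 * 3)"
      by (simp add: S_def of_nat_diff)
    also have "real (2 * R + 1) * real (2 * S + 1 - 2 * 3) = real ((2 * R + 1) * (2 * S + 1 - 2 * 3))"
      by (simp only: of_nat_mult)
    finally show ?thesis by (simp only: of_nat_less_iff)
  qed
  show False
    by (rule power_gap_contradiction[where a = a and b = b and c = c and z = z and t = t and K = K
          and M = 3 and R = R and S = S and \<rho> = \<rho>])
       (use a b t eq K0 \<rho> size zS points main zpos R g in
         \<open>auto simp: N_def \<mu>_def Q_def W_def S_def algebra_simps\<close>)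
qed

section \<open>Quadratic residues and biquadrates\<close>

lemma Legendre_eq_0_iff: "Legendre a p = 0 \<longleftrightarrow> p dvd a"
  by (auto simp: Legendre_def cong_0_iff)

lemma Legendre_cases: "Legendre a p \<in> {-1, 0, 1}"
  by (auto simp: Legendre_def)

lemma Legendre_cong:
  assumes "[a = b] (mod p)"
  shows "Legendre a p = Legendre b p"
proof -
  have "[a = 0] (mod p) \<longleftrightarrow> [b = 0] (mod p)" "QuadRes p a \<longleftrightarrow> QuadRes p b"
    using assms unfolding QuadRes_def by (meson cong_sym cong_trans)+
  then show ?thesis by (simp add: Legendre_def)
qed

lemma Legendre_square: "\<not> p dvd a \<Longrightarrow> prime p \<Longrightarrow> Legendre (a ^ 2) p = 1"
  by (auto simp: Legendre_def QuadRes_def cong_0_iff prime_dvd_power_iff intro: cong_refl)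

text \<open>Both sides lie in \<open>{-1, 0, 1}\<close>, so they differ by at most 2, which is less
  than \<open>p\<close>.\<close>

lemma Legendre_eqI:
  assumes "prime (p :: nat)" "2 < p" "[Legendre a p = s] (mod p)" "s \<in> {-1, 0, 1}"
  shows "Legendre a p = s"
proof -
  have "int p dvd Legendre a p - s" using assms(3) by (simp add: cong_iff_dvd_diff)
  moreover have "\<bar>Legendre a p - s\<bar> < int p"
    using Legendre_cases[of a p] assms(2,4) by auto
  ultimately have "Legendre a p - s = 0"
    using dvd_imp_le_int by (metis linorder_not_le abs_of_nat)
  then show ?thesis by simp
qed

lemma Legendre_mult:
  assumes "prime (p :: nat)" "2 < p"
  shows "Legendre (a * b) p = Legendre a p * Legendre b p"
proof (rule Legendre_eqI[OF assms])
  have "[Legendre a p * Legendre b p = a ^ ((p - 1) div 2) * b ^ ((p - 1) div 2)] (mod p)"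
    by (intro cong_mult euler_criterion assms)
  then show "[Legendre (a * b) p = Legendre a p * Legendre b p] (mod p)"
    using euler_criterion[OF assms, of "a * b"] by (metis cong_sym cong_trans power_mult_distrib)
qed (use Legendre_cases[of a p] Legendre_cases[of b p] in auto)

lemma Legendre_power:
  assumes "prime (p :: nat)" "2 < p"
  shows "Legendre (a ^ k) p = Legendre a p ^ k"
proof (induction k)
  case 0
  have "\<not> int p dvd 1" using assms by auto
  then show ?case using Legendre_square[of "int p" 1] assms by simp
qed (simp add: Legendre_mult[OF assms])

lemma Legendre_neg1:
  assumes "prime (p :: nat)" "2 < p"
  shows "Legendre (- 1) p = (if p mod 4 = 1 then 1 else - 1)"
proof (rule Legendre_eqI[OF assms])
  have "odd p" using assms prime_odd_nat by blast
  then have "p mod 4 = 1 \<or> p mod 4 = 3" by presburger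
  then have "(- 1 :: int) ^ ((p - 1) div 2) = (if p mod 4 = 1 then 1 else - 1)"
  proof
    assume "p mod 4 = 1"
    then have "even ((p - 1) div 2)" by presburger
    then show ?thesis using \<open>p mod 4 = 1\<close> by simp
  next
    assume p: "p mod 4 = 3"
    then have "odd ((p - 1) div 2)" by presburger
    then show ?thesis using p by simp
  qed
  then show "[Legendre (- 1) p = (if p mod 4 = 1 then 1 else - 1)] (mod p)"
    using euler_criterion[OF assms, of "-1"] by simp
qed auto

text \<open>Gauss's lemma with multiplier 2: the doubles of the numbers up to
  \<open>(p - 1) / 2\<close> need no reduction modulo \<open>p\<close>, so those above
  \<open>(p - 1) / 2\<close> can be counted directly, and the parity of the count depends on
  \<open>p mod 8\<close>.\<close>

lemma Legendre_2:
  assumes "prime (p :: nat)" "2 < p"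
  shows "Legendre 2 p = (if p mod 8 \<in> {1, 7} then 1 else - 1)"
proof -
  have odd: "odd p" using assms prime_odd_nat by blast
  have "\<not> int p dvd 2" using assms(2) zdvd_not_zless[of 2 "int p"] by simp
  then interpret GAUSS p 2
    using assms by unfold_locales (auto simp: cong_0_iff)
  let ?h = "(int p - 1) div 2"
  have h: "2 * ?h = int p - 1" using odd by simp
  have "C = B"
  proof -
    have "x mod int p = x" if "x \<in> B" for x
      using that h by (auto simp: B_def A_def intro!: mod_pos_pos_trivial)
    then show ?thesis unfolding C_def by simp
  qed
  then have "E = (\<lambda>x. x * 2) ` {?h div 2 <.. ?h}"
    unfolding E_def B_def A_def using h by (auto simp: image_iff)
  then have "card E = card {?h div 2 <.. ?h}"
    by (simp add: card_image inj_on_def)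
  then have card: "card E = nat (?h - ?h div 2)" by simp
  have "p mod 8 \<in> {1, 3, 5, 7}" using odd by simp presburger
  then obtain k where k: "p = 8 * k + 1 \<or> p = 8 * k + 3 \<or> p = 8 * k + 5 \<or> p = 8 * k + 7"
    by (metis insertE mult_div_mod_eq singletonD)
  have "even (card E) \<longleftrightarrow> p mod 8 \<in> {1, 7}"
  proof -
    have "card E = (if p = 8 * k + 1 then 2 * k else if p = 8 * k + 3 then 2 * k + 1
        else if p = 8 * k + 5 then 2 * k + 1 else 2 * k + 2)"
      unfolding card using k by auto
    then show ?thesis using k by auto
  qed
  then show ?thesis unfolding gauss_lemma by simp
qed

lemma Legendre_reciprocity_1_mod_4:
  assumes "prime (p :: nat)" "prime (q :: nat)" "p mod 4 = 1" "2 < q" "p \<noteq> q"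
  shows "Legendre q p = Legendre p q"
proof -
  have p: "2 < p" using assms(1,3) prime_ge_2_nat[of p] by (cases "p = 2") auto
  have "even ((p - 1) div 2)" using assms(3) by presburger
  then have "Legendre p q * Legendre q p = 1"
    using Quadratic_Reciprocity[OF assms(1) p assms(2,4,5)] by simp
  then show ?thesis using Legendre_cases[of "int p" "int q"] Legendre_cases[of "int q" "int p"] by auto
qed

lemma Legendre_prod_mset:
  assumes "prime (p :: nat)" "2 < p"
  shows "Legendre (int (prod_mset M)) p = (\<Prod>q\<in>#M. Legendre (int q) p)"
proof (induction M)
  case empty
  then show ?case using Legendre_power[OF assms, of _ 0] by simp
qed (simp add: Legendre_mult[OF assms])

text \<open>Reciprocity for Jacobi symbols, with multisets of primes as moduli. The primes in
  \<open>P\<close> are 1 modulo 4, so no sign arises when each pair is inverted.\<close>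

lemma Jacobi_reciprocity:
  assumes P: "\<And>p. p \<in># P \<Longrightarrow> prime (p :: nat) \<and> p mod 4 = 1"
    and Q: "\<And>q. q \<in># Q \<Longrightarrow> prime (q :: nat) \<and> 2 < q"
    and disj: "\<And>p. p \<in># P \<Longrightarrow> p \<notin># Q"
  shows "(\<Prod>p\<in>#P. Legendre (int (prod_mset Q)) (int p)) = (\<Prod>q\<in>#Q. Legendre (int (prod_mset P)) (int q))"
proof -
  have gt: "2 < p" if "p \<in># P" for p
    using P[OF that] prime_ge_2_nat[of p] by (cases "p = 2") auto
  have "(\<Prod>p\<in>#P. Legendre (int (prod_mset Q)) (int p)) = (\<Prod>p\<in>#P. \<Prod>q\<in>#Q. Legendre (int q) (int p))"
    using P gt by (intro arg_cong[of _ _ prod_mset] image_mset_cong Legendre_prod_mset) auto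
  also have "\<dots> = (\<Prod>p\<in>#P. \<Prod>q\<in>#Q. Legendre (int p) (int q))"
    using P Q disj by (intro arg_cong[of _ _ prod_mset] image_mset_cong Legendre_reciprocity_1_mod_4) auto
  also have "\<dots> = (\<Prod>q\<in>#Q. \<Prod>p\<in>#P. Legendre (int p) (int q))"
    by (induction P) (simp_all add: prod_mset.distrib)
  also have "\<dots> = (\<Prod>q\<in>#Q. Legendre (int (prod_mset P)) (int q))"
    using Q by (intro arg_cong[of _ _ prod_mset] image_mset_cong Legendre_prod_mset[symmetric]) auto
  finally show ?thesis .
qed

lemma prod_mset_mod_closed:
  fixes M :: "nat multiset"
  assumes "\<And>x. x \<in># M \<Longrightarrow> x mod k \<in> S" "1 mod k \<in> S" "\<And>x y. x \<in> S \<Longrightarrow> y \<in> S \<Longrightarrow> x * y mod k \<in> S"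
  shows "prod_mset M mod k \<in> S"
  using assms(1)
proof (induction M)
  case (add x M)
  then have "(x mod k) * (prod_mset M mod k) mod k \<in> S" by (intro assms(3)) auto
  then show ?case by (simp add: mod_mult_eq)
qed (use assms(2) in simp)

section \<open>Fermat's descent for differences of fourth powers\<close>

lemma coprime_mult_squareE:
  fixes u v w :: nat
  assumes "coprime u v" "u * v = w ^ 2" "0 < u" "0 < v"
  obtains g h where "u = g ^ 2" "v = h ^ 2"
proof -
  have "is_nth_power 2 (u * v)" unfolding assms(2) by simp
  then have "is_nth_power 2 u" "is_nth_power 2 v"
    using is_nth_power_mult_coprime_natD[OF assms(1)] assms(3,4) by blast+
  then show ?thesis using that by (auto elim!: is_nth_powerE)
qed

text \<open>Half the sum and half the difference of \<open>t\<close> and \<open>v\<close> are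
  coprime with product \<open>(u / 2)^2\<close>, hence both are squares. The additive form
  \<open>v + h ^ 2 = g ^ 2\<close> avoids truncated subtraction.\<close>

lemma primitive_pythagorean_triple:
  fixes u v t :: nat
  assumes "u ^ 2 + v ^ 2 = t ^ 2" "coprime u v" "even u" "0 < u"
  obtains g h where "u = 2 * g * h" "v + h ^ 2 = g ^ 2" "t = g ^ 2 + h ^ 2" "coprime g h"
proof -
  obtain k where k: "u = 2 * k" using assms(3) by blast
  have v: "odd v"
  proof
    assume "even v"
    then have "2 dvd gcd u v" using assms(3) by simp
    then show False using assms(2) by simp
  qed
  have "odd (u ^ 2 + v ^ 2)" using v assms(3) by simp
  then have t: "odd t" unfolding assms(1) by simp
  have "v ^ 2 < t ^ 2" using assms(1,4) by (metis less_add_same_cancel2 zero_less_power)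
  then have vt: "v < t" by (rule power_less_imp_less_base) simp
  obtain p where p: "t + v = 2 * p" using v t by (metis evenE odd_even_add)
  obtain q where q: "t - v = 2 * q" using v t by (metis evenE even_diff_nat odd_even_add)
  have tp: "t = p + q" "v + q = p" using p q vt by linarith+
  have "u ^ 2 = (t + v) * (t - v)"
    using assms(1) vt by (simp add: power2_eq_square algebra_simps diff_mult_distrib2)
  then have pq: "p * q = k ^ 2" unfolding p q k by (simp add: power2_eq_square)
  have "coprime p q"
  proof (rule coprimeI)
    fix d assume d: "d dvd p" "d dvd q"
    then have "d dvd v" using tp(2) by (metis dvd_add_left_iff)
    moreover have "d dvd t" using d tp(1) by simp
    ultimately have "d ^ 2 dvd v ^ 2" "d ^ 2 dvd u ^ 2 + v ^ 2" unfolding assms(1) by simp_all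
    then have "d ^ 2 dvd u ^ 2" by (metis dvd_add_left_iff)
    then have "d dvd u" by simp
    then show "is_unit d" using \<open>d dvd v\<close> assms(2) by (metis coprime_common_divisor)
  qed
  moreover have "0 < q" using q vt by (cases "q = 0") auto
  ultimately obtain g h where gh: "p = g ^ 2" "q = h ^ 2"
    using coprime_mult_squareE[of p q k] pq tp(2) by (metis add_gr_0)
  have "(g * h) ^ 2 = k ^ 2" using pq gh by (simp add: power_mult_distrib)
  then have "k = g * h" by simp
  then have 1: "u = 2 * g * h" using k by simp
  have 2: "v + h ^ 2 = g ^ 2" "t = g ^ 2 + h ^ 2" using tp gh by auto
  have 3: "coprime g h" using \<open>coprime p q\<close> gh by simp
  show ?thesis by (rule that[OF 1 2 3])
qed

text \<open>Two parametrizations make one descent step. From \<open>y^2 = 2 r s\<close> and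
  \<open>x^2 = r^2 + s^2\<close> the even one of \<open>r\<close>, \<open>s\<close> is
  \<open>2 e^2\<close> and the odd one \<open>f^2\<close>; parametrizing
  \<open>(2 e^2)^2 + (f^2)^2 = x^2\<close> yields squares \<open>g = i^2\<close>,
  \<open>h = j^2\<close> with \<open>i^4 = j^4 + f^2\<close> and \<open>i < x\<close>.\<close>

lemma biquadrate_difference_not_odd_square:
  fixes x y w :: nat
  assumes "x ^ 4 = y ^ 4 + w ^ 2" "coprime x y" "0 < y" "odd w"
  shows False
  using assms
proof (induction x arbitrary: y w rule: less_induct)
  case (less x)
  \<comment> \<open>Otherwise \<open>x ^ 4\<close> would be both divisible by 4 and a sum of two odd
    squares, which is 2 modulo 4.\<close>
  have y: "even y"
  proof (rule ccontr)
    assume y: "odd y"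
    then have "even (x ^ 4)" using less.prems by simp
    then obtain k where "x = 2 * k" by auto
    then have "x ^ 4 = 4 * (4 * k ^ 4)" by (simp add: power_mult_distrib)
    moreover obtain i j where ij: "y ^ 2 = 2 * i + 1" "w = 2 * j + 1"
      using y less.prems(4) by (metis oddE even_power)
    moreover have "y ^ 4 = (y ^ 2) ^ 2" by simp
    ultimately have "4 * (4 * k ^ 4) = (2 * i + 1) ^ 2 + (2 * j + 1) ^ 2"
      using less.prems(1) by metis
    also have "\<dots> = 4 * (i ^ 2 + i + j ^ 2 + j) + 2"
      by (simp add: power2_eq_square algebra_simps)
    finally obtain X Y :: nat where "4 * X = 4 * Y + 2" by blast
    then show False by presburger
  qed
  have "coprime (y ^ 4) (y ^ 4 + w ^ 2)"
    unfolding less.prems(1)[symmetric] using less.prems(2) by (simp add: coprime_commute)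
  then have "coprime (y ^ 4) (w ^ 2)"
    unfolding coprime_iff_gcd_eq_1 gcd_add2 .
  then have cop: "coprime (y ^ 2) w"
    by simp
  have "(y ^ 2) ^ 2 + w ^ 2 = (x ^ 2) ^ 2" using less.prems(1) by simp
  then obtain r s where rs: "y ^ 2 = 2 * r * s" "x ^ 2 = r ^ 2 + s ^ 2" "coprime r s"
    using primitive_pythagorean_triple[OF _ cop] y less.prems(3) by (metis even_power zero_less_power pos2)
  obtain k where k: "y = 2 * k" using y by blast
  have rsk: "r * s = 2 * k ^ 2" using rs(1) unfolding k by (simp add: power2_eq_square)
  then have "even (r * s)" by simp
  then obtain E O' where EO: "even E" "E * O' = r * s" "coprime E O'" "x ^ 2 = E ^ 2 + O' ^ 2"
    using rs by (metis add.commute coprime_commute even_mult_iff mult.commute)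
  obtain E' where E': "E = 2 * E'" using EO(1) by blast
  have O': "odd O'" using EO(1,3) by (metis coprime_common_divisor odd_one)
  have pr: "E' * O' = k ^ 2" using EO(2) rsk unfolding E' by simp
  have k0: "0 < k" using less.prems(3) k by simp
  then have pos: "0 < E'" "0 < O'" using pr by (metis mult_is_0 neq0_conv power_not_zero)+
  have "coprime E' O'" using EO(3) unfolding E' by simp
  then obtain e f where ef: "E' = e ^ 2" "O' = f ^ 2"
    using coprime_mult_squareE[OF _ pr pos] by blast
  have "(2 * e ^ 2) ^ 2 + (f ^ 2) ^ 2 = x ^ 2" using EO(4) unfolding E' ef by simp
  moreover have "coprime (2 * e ^ 2) (f ^ 2)" using EO(3) unfolding E' ef .
  ultimately obtain g h where gh: "2 * e ^ 2 = 2 * g * h" "f ^ 2 + h ^ 2 = g ^ 2" "x = g ^ 2 + h ^ 2" "coprime g h"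
    using primitive_pythagorean_triple[of "2 * e ^ 2" "f ^ 2" x] pos(1) unfolding ef by (metis dvd_triv_left nat_0_less_mult_iff pos2)
  have ghe: "g * h = e ^ 2" using gh(1) by simp
  have e0: "0 < e" using pos(1) ef by simp
  then have pos': "0 < g" "0 < h" using ghe by (metis mult_is_0 neq0_conv power_not_zero)+
  obtain i j where ij: "g = i ^ 2" "h = j ^ 2"
    using coprime_mult_squareE[OF gh(4) ghe pos'] by blast
  have "i ^ 4 = j ^ 4 + f ^ 2" using gh(2) unfolding ij by simp
  moreover have "coprime i j" using gh(4) unfolding ij by simp
  moreover have "0 < j" using pos'(2) ij by simp
  moreover have "odd f" using O' ef by simp
  moreover have "i < x"
  proof -
    have "i \<le> g ^ 2" unfolding ij using self_le_power[of i 4] pos'(1) ij by (cases "i = 0") auto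
    then show ?thesis using gh(3) pos'(2) by (simp add: less_le_trans[of i "g ^ 2 + 1"] Suc_leI)
  qed
  ultimately show False using less.IH by blast
qed

text \<open>With \<open>w = 2 r s\<close> the identity
  \<open>r^4 - s^4 = (r^2 - s^2) (r^2 + s^2) = (x y)^2\<close> leads back to the odd case.\<close>

lemma biquadrate_difference_not_square:
  fixes x y w :: nat
  assumes "x ^ 4 = y ^ 4 + w ^ 2" "coprime x y" "0 < y" "even w" "0 < w"
  shows False
proof -
  have eq: "w ^ 2 + (y ^ 2) ^ 2 = (x ^ 2) ^ 2" using assms(1) by simp
  have "coprime (y ^ 4) (y ^ 4 + w ^ 2)"
    unfolding assms(1)[symmetric] using assms(2) by (simp add: coprime_commute)
  then have "coprime (y ^ 4) (w ^ 2)"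
    unfolding coprime_iff_gcd_eq_1 gcd_add2 .
  then have cop: "coprime w (y ^ 2)" by (simp add: coprime_commute)
  obtain r s where rs: "w = 2 * r * s" "y ^ 2 + s ^ 2 = r ^ 2" "x ^ 2 = r ^ 2 + s ^ 2" "coprime r s"
    using primitive_pythagorean_triple[OF eq cop assms(4,5)] by blast
  have "r ^ 4 = (s ^ 2 + y ^ 2) * r ^ 2" using rs(2) by (simp add: power4_eq_xxxx power2_eq_square add.commute)
  also have "\<dots> = s ^ 2 * (y ^ 2 + s ^ 2) + y ^ 2 * r ^ 2" unfolding rs(2) by (simp add: algebra_simps)
  also have "\<dots> = s ^ 4 + y ^ 2 * (r ^ 2 + s ^ 2)" by (simp add: power4_eq_xxxx power2_eq_square algebra_simps)
  also have "\<dots> = s ^ 4 + (x * y) ^ 2" unfolding rs(3)[symmetric] by (simp add: power_mult_distrib)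
  finally have "r ^ 4 = s ^ 4 + (x * y) ^ 2" .
  moreover have "odd (x * y)"
  proof -
    have "odd (y ^ 2)" using cop assms(4) by (metis coprime_common_divisor odd_one)
    then show ?thesis using assms(1,4) by (metis even_add even_mult_iff even_power pos2 zero_less_numeral)
  qed
  moreover have "0 < s" using rs(1) assms(5) by (cases "s = 0") auto
  ultimately show False using biquadrate_difference_not_odd_square rs(4) by blast
qed

section \<open>The exponential equation\<close>

lemma odd_square_power_mod_8:
  fixes u :: int
  assumes "odd u" "even k"
  shows "u ^ k mod 8 = 1"
proof -
  obtain j where j: "k = 2 * j" using assms(2) by blast
  have "u mod 8 = 1 \<or> u mod 8 = 3 \<or> u mod 8 = 5 \<or> u mod 8 = 7" using assms(1) by presburger
  then have "(u mod 8)\<^sup>2 mod 8 = 1" by auto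
  then have "u\<^sup>2 mod 8 = 1" by (simp add: power_mod)
  moreover have "(u\<^sup>2) ^ j mod 8 = (u\<^sup>2 mod 8) ^ j mod 8" by (simp add: power_mod)
  ultimately have "(u\<^sup>2) ^ j mod 8 = 1" by (simp only: power_one) simp
  then show ?thesis by (simp add: j power_mult)
qed

lemma odd_power_mod_8:
  fixes u :: int
  assumes "odd u" "odd k"
  shows "u ^ k mod 8 = u mod 8"
proof -
  obtain j where j: "k = Suc (2 * j)" using assms(2) by (metis oddE Suc_eq_plus1)
  have "u ^ (2 * j) mod 8 = 1" using assms(1) by (intro odd_square_power_mod_8) auto
  then show ?thesis unfolding j power_Suc by (metis mod_mult_right_eq mult.right_neutral)
qed

text \<open>The residues 1 and 3 form a group modulo 8, and sending 1 to 1 and 3 to -1 is a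
  character of it, the one given by \<open>Legendre 2\<close>.\<close>

lemma prod_mset_sign_mod_8:
  fixes M :: "nat multiset" and f :: "nat \<Rightarrow> int"
  assumes "\<And>q. q \<in># M \<Longrightarrow> q mod 8 \<in> {1, 3} \<and> f q = (if q mod 8 = 1 then 1 else - 1)"
  shows "prod_mset M mod 8 \<in> {1, 3} \<and> (\<Prod>q\<in>#M. f q) = (if prod_mset M mod 8 = 1 then 1 else - 1)"
  using assms
proof (induction M)
  case (add q M)
  have "prod_mset (add_mset q M) mod 8 = (q mod 8) * (prod_mset M mod 8) mod 8"
    by (simp add: mod_mult_eq)
  moreover have "q mod 8 \<in> {1, 3} \<and> f q = (if q mod 8 = 1 then 1 else - 1)"
    "prod_mset M mod 8 \<in> {1, 3} \<and> (\<Prod>q\<in>#M. f q) = (if prod_mset M mod 8 = 1 then 1 else - 1)"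
    using add by auto
  ultimately show ?case by auto
qed simp

lemma power_diff_ge:
  fixes u v :: int
  assumes "0 < v" "v \<le> u" "0 < k"
  shows "u - v \<le> u ^ k - v ^ k"
  using assms(3)
proof (induction k rule: nat_induct_non_zero)
  case (Suc k)
  have "u - v \<le> (u ^ k - v ^ k) * 1" using Suc by simp
  also have "\<dots> \<le> (u ^ k - v ^ k) * v"
    using assms power_mono[of v u k] by (intro mult_left_mono) auto
  also have "\<dots> \<le> (u ^ k - v ^ k) * v + u ^ k * (u - v)"
    using assms by simp
  also have "\<dots> = u ^ Suc k - v ^ Suc k" by (simp add: algebra_simps)
  finally show ?case .
qed simp

lemma power_diff_ge_square:
  fixes u w :: int
  assumes "0 < w" "w < u" "3 \<le> d"
  shows "w\<^sup>2 \<le> u ^ d - w ^ d"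
proof -
  obtain k where k: "d = Suc k" "2 \<le> k" using assms(3) by (metis Suc_le_D Suc_le_mono numeral_3_eq_3 numeral_2_eq_2)
  have "w\<^sup>2 \<le> w ^ k" using assms(1) k(2) by (intro power_increasing) auto
  moreover have "(w + 1) * w ^ k \<le> u * u ^ k"
    using assms by (intro mult_mono power_mono) auto
  ultimately show ?thesis unfolding k(1) by (simp add: algebra_simps)
qed

lemma prime_factorization_of_pos_int:
  assumes "0 < (k :: int)"
  shows "int (prod_mset (prime_factorization (nat k))) = k"
    "p \<in># prime_factorization (nat k) \<Longrightarrow> prime p \<and> int p dvd k"
proof -
  show "int (prod_mset (prime_factorization (nat k))) = k"
    using assms by (subst prod_mset_prime_factorization_nat) auto
  assume "p \<in># prime_factorization (nat k)"
  then have "prime p" "p dvd nat k" by (auto simp: in_prime_factors_iff)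
  then show "prime p \<and> int p dvd k" using assms by (simp add: int_dvd_int_iff[symmetric] nat_dvd_iff)
qed

locale jesmanowicz_triple =
  fixes m n a b c :: int
  assumes n_pos: "0 < n" and n_less_m: "n < m" and cop_mn: "coprime m n" and mn: "m * n mod 4 = 2"
    and a_def: "a = m\<^sup>2 - n\<^sup>2" and b_def: "b = 2 * m * n" and c_def: "c = m\<^sup>2 + n\<^sup>2"
begin

lemma m_pos: "0 < m"
  using n_pos n_less_m by linarith

lemma pos: "0 < a" "0 < b" "0 < c"
proof -
  have "n * n < m * m" using n_pos n_less_m by (intro mult_strict_mono) auto
  then show "0 < a" by (simp add: a_def power2_eq_square)
  show "0 < b" "0 < c" using n_pos m_pos by (auto simp: b_def c_def add_pos_pos)
qed

lemma a_factor: "a = (m - n) * (m + n)"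
  by (simp add: a_def power2_eq_square algebra_simps)

lemma pythagoras: "a\<^sup>2 + b\<^sup>2 = c\<^sup>2"
  by (simp add: a_def b_def c_def power2_eq_square algebra_simps)

text \<open>One of \<open>m\<close>, \<open>n\<close> is odd and the other is twice an odd number,
  so their squares are 1 and 4 modulo 8.\<close>

lemma mod_8: "c mod 8 = 5" "b mod 8 = 4" "a mod 8 = 3 \<or> a mod 8 = 5"
proof -
  define i j where "i = m mod 8" and "j = n mod 8"
  have i: "i \<in> {0, 1, 2, 3, 4, 5, 6, 7}" and j: "j \<in> {0, 1, 2, 3, 4, 5, 6, 7}"
    unfolding i_def j_def by simp_all presburger+
  have "m mod 4 = i mod 4" "n mod 4 = j mod 4"
    unfolding i_def j_def by (simp_all add: mod_mod_cancel)
  then have ij: "i * j mod 4 = 2" using mn by (metis mod_mult_eq)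
  have "c mod 8 = (i\<^sup>2 + j\<^sup>2) mod 8" "a mod 8 = (i\<^sup>2 - j\<^sup>2) mod 8"
    unfolding c_def a_def cong_def[symmetric]
    by (intro cong_add cong_diff cong_pow; simp add: cong_def i_def j_def)+
  then show "c mod 8 = 5" "a mod 8 = 3 \<or> a mod 8 = 5" using i j ij by auto
  have "m * n = 4 * (m * n div 4) + 2" using mn by presburger
  then have "b = 8 * (m * n div 4) + 4" unfolding b_def by simp
  then show "b mod 8 = 4" by simp
qed

lemma odd_a_c: "odd a" "odd c"
  using mod_8(1,3) by presburger+

lemma coprime_cb: "coprime c b"
proof -
  have "coprime m (m * m + n\<^sup>2)" "coprime n (n * n + m\<^sup>2)"
    using cop_mn unfolding coprime_iff_gcd_eq_1 gcd_add_mult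
    by (simp_all add: coprime_commute flip: coprime_iff_gcd_eq_1)
  then have "coprime c m" "coprime c n" by (simp_all add: c_def power2_eq_square coprime_commute add.commute)
  moreover have "coprime c 2" using odd_a_c(2) by simp
  ultimately show ?thesis by (simp add: b_def)
qed

lemma coprime_ca: "coprime c a"
proof -
  have "coprime (c\<^sup>2) (b\<^sup>2)" using coprime_cb by simp
  then have "coprime (b\<^sup>2) (b\<^sup>2 + a\<^sup>2)" using pythagoras by (simp add: coprime_commute add.commute)
  then have "coprime (a\<^sup>2) (b\<^sup>2)" unfolding coprime_iff_gcd_eq_1 gcd_add2 by (simp add: gcd.commute)
  then have "coprime (a\<^sup>2) (a\<^sup>2 + b\<^sup>2)" unfolding coprime_iff_gcd_eq_1 gcd_add2 .
  then show ?thesis unfolding pythagoras by (simp add: coprime_commute)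
qed

text \<open>Modulo \<open>p\<close>, -1 is the square of \<open>m / n\<close>, and \<open>b\<close>
  is the square of \<open>m + n\<close> because \<open>(m + n)^2 - b = c\<close>.\<close>

lemma prime_factor_c:
  assumes p: "prime p" "int p dvd c"
  shows "\<not> int p dvd m" "\<not> int p dvd n" "\<not> int p dvd b" "2 < p" "p mod 4 = 1" "Legendre b p = 1"
proof -
  have nu: "\<not> is_unit (int p)" using p(1) by auto
  show nb: "\<not> int p dvd b" using coprime_common_divisor[OF coprime_cb p(2)] nu by blast
  then show nm: "\<not> int p dvd m" and nn: "\<not> int p dvd n" by (auto simp: b_def)
  have "p \<noteq> 2" using p(2) odd_a_c(2) by auto
  then show p2: "2 < p" using prime_ge_2_nat[OF p(1)] by simp
  have "[m\<^sup>2 = - 1 * n\<^sup>2] (mod p)" using p(2) by (simp add: c_def cong_iff_dvd_diff)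
  then have "Legendre (m\<^sup>2) p = Legendre (- 1) p * Legendre (n\<^sup>2) p"
    using Legendre_cong Legendre_mult[OF p(1) p2] by metis
  then have "Legendre (- 1) p = 1" using Legendre_square p(1) nm nn by simp
  then show "p mod 4 = 1" using Legendre_neg1[OF p(1) p2] by (simp split: if_splits)
  have "[(m + n)\<^sup>2 = b] (mod p)"
    using p(2) by (simp add: c_def b_def cong_iff_dvd_diff power2_eq_square algebra_simps)
  then have "\<not> int p dvd (m + n)\<^sup>2" using nb by (simp add: cong_dvd_iff)
  then show "Legendre b p = 1"
    using Legendre_cong[OF \<open>[(m + n)\<^sup>2 = b] (mod p)\<close>] Legendre_square[of "int p" "m + n"] p(1)
    by (simp add: prime_dvd_power_iff)
qed

text \<open>Prime factors of \<open>c\<close> are 1 or 5 modulo 8, and a product of primes that are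
  all 1 modulo 8 cannot be 5.\<close>

lemma ex_prime_factor_5_mod_8: "\<exists>p. prime p \<and> int p dvd c \<and> p mod 8 = 5"
proof (rule ccontr)
  assume none: "\<not> ?thesis"
  have "prod_mset (prime_factorization (nat c)) mod 8 \<in> {1}"
  proof (rule prod_mset_mod_closed)
    fix p assume "p \<in># prime_factorization (nat c)"
    then have p: "prime p" "int p dvd c" using prime_factorization_of_pos_int(2)[OF pos(3)] by auto
    then have "p mod 4 = 1" "p mod 8 \<noteq> 5" using prime_factor_c(5) none by auto
    then show "p mod 8 \<in> {1}" by simp presburger
  qed auto
  then have "int (prod_mset (prime_factorization (nat c)) mod 8) = 1" by simp
  then show False using prime_factorization_of_pos_int(1)[OF pos(3)] mod_8(1) by (simp only: zmod_int) simp
qed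

section \<open>Parity of the exponents\<close>

text \<open>For a prime factor \<open>p\<close> of \<open>c\<close> with \<open>p mod 8 = 5\<close>,
  \<open>a\<close> is congruent to the nonresidue \<open>2 m^2\<close>, while
  \<open>- (b ^ y)\<close> is a residue since -1 and \<open>b\<close> are.\<close>

lemma even_x:
  assumes eq: "a ^ x + b ^ y = c ^ z" and "0 < z"
  shows "even x"
proof -
  obtain p where p: "prime p" "int p dvd c" "p mod 8 = 5" using ex_prime_factor_5_mod_8 by blast
  note pf = prime_factor_c[OF p(1,2)]
  have "int p dvd c ^ z" using p(2) \<open>0 < z\<close> by (meson dvd_power_le dvd_refl dvd_trans dvd_power)
  then have "[a ^ x = - 1 * b ^ y] (mod p)" unfolding eq[symmetric] by (simp add: cong_iff_dvd_diff)
  then have "Legendre a p ^ x = Legendre (- 1) p * Legendre b p ^ y"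
    using Legendre_cong Legendre_mult[OF p(1) pf(4)] Legendre_power[OF p(1) pf(4)] by metis
  also have "\<dots> = 1" using pf Legendre_neg1[OF p(1) pf(4)] by simp
  finally have 1: "Legendre a p ^ x = 1" .
  have "[a = 2 * m\<^sup>2] (mod p)"
    using p(2) by (simp add: a_def c_def cong_iff_dvd_diff algebra_simps dvd_diff_commute)
  then have "Legendre a p = Legendre 2 p * Legendre (m\<^sup>2) p"
    using Legendre_cong Legendre_mult[OF p(1) pf(4)] by metis
  also have "\<dots> = - 1" using Legendre_2[OF p(1) pf(4)] Legendre_square[OF pf(1)] p by simp
  finally have "(- 1 :: int) ^ x = 1" using 1 by simp
  then show "even x" by (metis neg_one_odd_power one_neq_neg_one)
qed

text \<open>Modulo 8 the term \<open>b ^ y\<close> vanishes and \<open>a ^ x\<close> is 1, but an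
  odd power of \<open>c\<close> is 5.\<close>

lemma even_z:
  assumes eq: "a ^ x + b ^ y = c ^ z" and "0 < z" "2 \<le> y"
  shows "even z"
proof (rule ccontr)
  assume z: "odd z"
  have "8 dvd b ^ y"
  proof -
    have "4 dvd b" using mod_8(2) by presburger
    then have "4 ^ 2 dvd b ^ 2" by (rule dvd_power_same)
    also have "b ^ 2 dvd b ^ y" using assms(3) by (rule le_imp_power_dvd)
    finally have "16 dvd b ^ y" by simp
    then show ?thesis by (rule dvd_trans[rotated]) simp
  qed
  moreover have "a ^ x mod 8 = 1" using odd_square_power_mod_8 odd_a_c(1) even_x[OF eq assms(2)] by blast
  ultimately have "(a ^ x + b ^ y) mod 8 = 1" by presburger
  then show False using odd_power_mod_8[OF odd_a_c(2) z] mod_8(1) unfolding eq by simp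
qed

text \<open>Now \<open>b\<close> is 4 modulo 8, so \<open>c ^ z\<close> is 5 there and not an even
  power of an odd number.\<close>

lemma odd_z:
  assumes eq: "a ^ x + b = c ^ z" and "0 < z"
  shows "odd z"
proof
  assume z: "even z"
  have "a ^ x mod 8 = 1" using odd_square_power_mod_8 odd_a_c(1) even_x[of x 1 z] assms by simp
  moreover have "c ^ z mod 8 = 1" using odd_square_power_mod_8 odd_a_c(2) z by blast
  ultimately show False using eq mod_8(2) by presburger
qed

text \<open>For \<open>q\<close> dividing \<open>m - n\<close>, both \<open>b\<close> and
  \<open>c\<close> are \<open>2 n^2\<close> modulo \<open>q\<close>; \<open>y\<close> odd and
  \<open>z\<close> even force \<open>(2 / q) = 1\<close>. For \<open>q\<close> dividing
  \<open>m + n\<close>, they are \<open>-2 n^2\<close> and \<open>2 n^2\<close>, which forces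
  \<open>(-2 / q) = 1\<close>. Hence \<open>m - n\<close> is 1 or 7 and \<open>m + n\<close> is 1 or
  3 modulo 8; if \<open>m + n\<close> were 1, then \<open>a\<close> would be 1 or 7, against
  \<open>mod_8\<close>.\<close>

lemma m_plus_n_mod_8:
  assumes eq: "a ^ x + b ^ y = c ^ z" and "0 < x" "0 < z" "2 \<le> y" "odd y"
  shows "(m + n) mod 8 = 3" "\<And>q. prime q \<Longrightarrow> int q dvd m + n \<Longrightarrow> 2 < q \<and> \<not> int q dvd n \<and> q mod 8 \<in> {1, 3}"
proof -
  have z: "even z" by (rule even_z[OF eq assms(3,4)])
  have bc: "[b ^ y = c ^ z] (mod q)" if "q dvd a" for q
  proof -
    have "q dvd a ^ x" using that \<open>0 < x\<close> by (meson dvd_power dvd_trans)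
    then show ?thesis unfolding eq[symmetric] by (simp add: cong_iff_dvd_diff)
  qed
  have gt2: "2 < q" if "prime q" "int q dvd a" for q
  proof -
    have "q \<noteq> 2" using that odd_a_c(1) by auto
    then show ?thesis using prime_ge_2_nat[OF that(1)] by simp
  qed
  have two: "Legendre (2 * n\<^sup>2) q = Legendre 2 q" if "prime q" "2 < q" "\<not> int q dvd n" for q
    using that by (simp add: Legendre_mult Legendre_square)
  have one_of: "s = 1" if "s ^ y = t ^ z" "s \<in> {-1, 1}" "t \<in> {-1, 1}" for s t :: int
    using that z \<open>odd y\<close> by auto
  have L2: "Legendre 2 q \<in> {-1, 1}" "Legendre (- 1) q \<in> {-1, 1}" if "prime q" "2 < q" for q :: nat
    using Legendre_2[OF that] Legendre_neg1[OF that] by auto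
  have minus: "q mod 8 \<in> {1, 7}" if q: "prime q" "int q dvd m - n" for q
  proof -
    have qa: "int q dvd a" using q(2) by (simp add: a_factor)
    note q2 = gt2[OF q(1) qa]
    have qn: "\<not> int q dvd n"
    proof
      assume "int q dvd n"
      moreover from this q(2) have "int q dvd m" by (metis dvd_diff_commute dvd_add_right_iff diff_add_cancel)
      ultimately show False using cop_mn q(1) by (metis coprime_common_divisor not_prime_unit prime_nat_int_transfer)
    qed
    have "b - 2 * n\<^sup>2 = (m - n) * (2 * n)" "c - 2 * n\<^sup>2 = (m - n) * (m + n)"
      by (simp_all add: b_def c_def power2_eq_square algebra_simps)
    then have "[b = 2 * n\<^sup>2] (mod q)" "[c = 2 * n\<^sup>2] (mod q)"
      using q(2) by (simp_all add: cong_iff_dvd_diff)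
    then have "Legendre b q = Legendre 2 q" "Legendre c q = Legendre 2 q"
      using Legendre_cong two[OF q(1) q2 qn] by metis+
    then have "Legendre 2 q ^ y = Legendre 2 q ^ z"
      using Legendre_cong[OF bc[OF qa]] by (simp add: Legendre_power[OF q(1) q2])
    then have "Legendre 2 q = 1" using one_of L2[OF q(1) q2] by blast
    then show ?thesis using Legendre_2[OF q(1) q2] by (simp split: if_splits)
  qed
  show plus: "2 < q \<and> \<not> int q dvd n \<and> q mod 8 \<in> {1, 3}" if q: "prime q" "int q dvd m + n" for q
  proof -
    have qa: "int q dvd a" using q(2) by (simp add: a_factor)
    note q2 = gt2[OF q(1) qa]
    have qn: "\<not> int q dvd n"
    proof
      assume "int q dvd n"
      moreover from this q(2) have "int q dvd m" by (simp add: dvd_add_left_iff)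
      ultimately show False using cop_mn q(1) by (metis coprime_common_divisor not_prime_unit prime_nat_int_transfer)
    qed
    have "b - - 1 * (2 * n\<^sup>2) = (m + n) * (2 * n)" "c - 2 * n\<^sup>2 = (m + n) * (m - n)"
      by (simp_all add: b_def c_def power2_eq_square algebra_simps)
    then have "[b = - 1 * (2 * n\<^sup>2)] (mod q)" "[c = 2 * n\<^sup>2] (mod q)"
      unfolding cong_iff_dvd_diff using q(2) by simp_all
    then have "Legendre b q = Legendre (- 1) q * Legendre 2 q" "Legendre c q = Legendre 2 q"
      using Legendre_cong two[OF q(1) q2 qn] Legendre_mult[OF q(1) q2] by metis+
    then have "(Legendre (- 1) q * Legendre 2 q) ^ y = Legendre 2 q ^ z"
      using Legendre_cong[OF bc[OF qa]] by (simp add: Legendre_power[OF q(1) q2])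
    moreover have "Legendre (- 1) q * Legendre 2 q \<in> {-1, 1}" using L2[OF q(1) q2] by auto
    ultimately have "Legendre (- 1) q * Legendre 2 q = 1" using one_of L2[OF q(1) q2] by blast
    then have "q mod 4 = 1 \<longleftrightarrow> q mod 8 \<in> {1, 7}"
      using Legendre_2[OF q(1) q2] Legendre_neg1[OF q(1) q2] by (simp split: if_splits)
    moreover have "odd q" using q(1) q2 prime_odd_nat by blast
    ultimately have "q mod 8 \<in> {1, 3}" by simp presburger
    then show ?thesis using q2 qn by blast
  qed
  have "prod_mset (prime_factorization (nat (m - n))) mod 8 \<in> {1, 7}"
    using minus prime_factorization_of_pos_int(2)[of "m - n"] n_less_m by (intro prod_mset_mod_closed) auto
  then have "int (prod_mset (prime_factorization (nat (m - n))) mod 8) \<in> {1, 7}" by auto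
  then have 1: "(m - n) mod 8 \<in> {1, 7}"
    using prime_factorization_of_pos_int(1)[of "m - n"] n_less_m by (simp only: zmod_int) simp
  have "prod_mset (prime_factorization (nat (m + n))) mod 8 \<in> {1, 3}"
    using plus prime_factorization_of_pos_int(2)[of "m + n"] n_pos m_pos by (intro prod_mset_mod_closed) auto
  then have "int (prod_mset (prime_factorization (nat (m + n))) mod 8) \<in> {1, 3}" by auto
  then have 2: "(m + n) mod 8 \<in> {1, 3}"
    using prime_factorization_of_pos_int(1)[of "m + n"] n_pos m_pos by (simp only: zmod_int) simp
  have "a mod 8 = ((m - n) mod 8) * ((m + n) mod 8) mod 8" unfolding a_factor by (rule mod_mult_eq[symmetric])
  then show "(m + n) mod 8 = 3" using 1 2 mod_8(3) by auto
qed

section \<open>The case y >= 2\<close>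

text \<open>The halves of \<open>c ^ Z - a ^ X\<close> and \<open>c ^ Z + a ^ X\<close> are coprime
  with product \<open>b ^ y / 4\<close>. The even half takes all of \<open>4 ^ (y - 1)\<close>, and
  what remains is a coprime factorization of a \<open>y\<close>-th power. Either half may be the
  even one, hence the two signs of \<open>a ^ X\<close>.\<close>

lemma coprime_power_split:
  assumes eq: "a ^ (2 * X) + b ^ y = c ^ (2 * Z)" and "0 < Z" "2 \<le> y"
  obtains P Q :: nat where "odd P" "c ^ Z = int P ^ y + 4 ^ (y - 1) * int Q ^ y"
    "a ^ X = int P ^ y - 4 ^ (y - 1) * int Q ^ y \<or> - (a ^ X) = int P ^ y - 4 ^ (y - 1) * int Q ^ y"
    "4 * (int P * int Q) = b"
proof -
  have odds: "odd (c ^ Z)" "odd (a ^ X)" using odd_a_c by auto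
  have "4 dvd b" using mod_8(2) by presburger
  then obtain B where B: "b = 4 * B" by (rule dvdE)
  have oddB: "odd B" using mod_8(2) B by presburger
  have "(a ^ X)\<^sup>2 < (c ^ Z)\<^sup>2" using eq pos(2) by (simp add: power_mult mult.commute flip: power_mult) (metis less_add_same_cancel1 zero_less_power)
  then have lt: "a ^ X < c ^ Z" using pos by (intro power_less_imp_less_base[of "a ^ X" 2]) auto
  have "even (c ^ Z - a ^ X)" "even (c ^ Z + a ^ X)" using odds by (simp_all del: even_power)
  then obtain u v where u: "c ^ Z - a ^ X = 2 * u" and v: "c ^ Z + a ^ X = 2 * v" by (elim evenE)
  have uv: "c ^ Z = u + v" "a ^ X = v - u" using u v by linarith+
  have "b ^ y = c ^ (2 * Z) - a ^ (2 * X)" using eq by simp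
  also have "\<dots> = (c ^ Z - a ^ X) * (c ^ Z + a ^ X)"
    unfolding mult_2 power_add by (simp add: algebra_simps)
  also have "\<dots> = 4 * (u * v)" unfolding u v by simp
  finally have uvb: "4 * (u * v) = 4 * (4 ^ (y - 1) * B ^ y)"
    using assms(3) unfolding B power_mult_distrib by (cases y) auto
  then have prod: "u * v = 4 ^ (y - 1) * B ^ y" by simp
  have upos: "0 < u" "0 < v" using lt u v pos zero_less_power[OF pos(1), of X] by linarith+
  have cop: "coprime u v"
  proof (rule coprimeI)
    fix d assume d: "d dvd u" "d dvd v"
    then have "d dvd c ^ Z" "d dvd a ^ X" unfolding uv by simp_all
    moreover have "coprime (c ^ Z) (a ^ X)" using coprime_ca by simp
    ultimately show "is_unit d" by (metis coprime_common_divisor)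
  qed
  have "\<exists>E F. odd F \<and> coprime F E \<and> F * E = 4 ^ (y - 1) * B ^ y \<and> 0 < E \<and> 0 < F \<and> c ^ Z = F + E \<and>
      (a ^ X = F - E \<or> - (a ^ X) = F - E)"
  proof (cases "odd u")
    case True
    then show ?thesis using cop prod upos uv by (intro exI[of _ v] exI[of _ u]) auto
  next
    case False
    then have "odd v" using odds(1) uv(1) by simp
    then show ?thesis using cop prod upos uv
      by (intro exI[of _ u] exI[of _ v]) (auto simp: coprime_commute mult.commute)
  qed
  then obtain E F where EF: "odd F" "coprime F E" "F * E = 4 ^ (y - 1) * B ^ y" "0 < E" "0 < F"
    "c ^ Z = F + E" "a ^ X = F - E \<or> - (a ^ X) = F - E" by blast
  have "coprime (4 ^ (y - 1)) F"
  proof -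
    have "coprime 2 F" using EF(1) by simp
    then have "coprime (2 ^ (2 * (y - 1))) F" by simp
    then show ?thesis by (simp add: power_mult)
  qed
  moreover have "4 ^ (y - 1) dvd F * E" unfolding EF(3) by simp
  ultimately have "4 ^ (y - 1) dvd E" by (simp add: coprime_dvd_mult_right_iff)
  then obtain E' where E': "E = 4 ^ (y - 1) * E'" by blast
  have FE: "F * E' = B ^ y" using EF(3) unfolding E' by simp
  have E'pos: "0 < E'" using EF(4) unfolding E' by (simp add: zero_less_mult_iff)
  have Bpos: "0 < B" using pos(2) B by simp
  have "nat F * nat E' = nat B ^ y"
    using FE EF(5) E'pos Bpos by (metis nat_mult_distrib nat_power_eq less_imp_le)
  moreover have "coprime (nat F) (nat E')"
  proof -
    have "coprime F E'" using EF(2) unfolding E' by simp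
    then show ?thesis using EF(5) E'pos by (simp flip: coprime_int_iff)
  qed
  ultimately have "is_nth_power y (nat F)" "is_nth_power y (nat E')"
    using is_nth_power_mult_coprime_natD[of "nat F" "nat E'" y] EF(5) E'pos by auto
  then obtain P Q where "nat F = P ^ y" "nat E' = Q ^ y" by (auto elim!: is_nth_powerE)
  then have PQ: "F = int P ^ y" "E' = int Q ^ y" using EF(5) E'pos by (metis int_nat_eq less_imp_le of_nat_power)+
  have "(int P * int Q) ^ y = B ^ y" using FE unfolding PQ power_mult_distrib .
  then have "int P * int Q = B"
    by (rule power_eq_imp_eq_base) (use assms(3) Bpos in simp_all)
  then have "4 * (int P * int Q) = b" using B by simp
  moreover have "odd P" using EF(1) assms(3) unfolding PQ by auto
  ultimately show ?thesis using that EF(6,7) unfolding E' PQ by blast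
qed

text \<open>Reciprocity turns the product of the symbols over the primes of \<open>c\<close> into
  symbols of \<open>c\<close>. For \<open>q\<close> dividing \<open>m + n\<close>, \<open>c\<close>
  is \<open>2 n^2\<close> modulo \<open>q\<close>, and the symbols \<open>(2 / q)\<close> multiply
  to -1 since \<open>m + n\<close> is 3 modulo 8. A prime \<open>q\<close> dividing \<open>Q\<close>
  divides \<open>m\<close> or \<open>n\<close>, so \<open>c\<close> is a square modulo
  \<open>q\<close> and this part contributes 1.\<close>

lemma y_not_odd:
  assumes eq: "a ^ x + b ^ y = c ^ z" and "0 < x" "0 < z" "2 \<le> y"
  shows "even y"
proof (rule ccontr)
  assume y: "odd y"
  obtain X Z where XZ: "x = 2 * X" "z = 2 * Z"
    using even_x[OF eq assms(3)] even_z[OF eq assms(3,4)] by blast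
  have Zpos: "0 < Z" using assms(3) XZ(2) by simp
  obtain P Q where PQ: "odd P" "c ^ Z = int P ^ y + 4 ^ (y - 1) * int Q ^ y" "4 * (int P * int Q) = b"
    using coprime_power_split[OF eq[unfolded XZ] Zpos assms(4)] by blast
  note mn8 = m_plus_n_mod_8[OF eq assms(2-4) y]
  have Qpos: "0 < Q" using PQ(3) pos(2) by (cases "Q = 0") auto
  have oddQ: "odd Q"
  proof
    assume "even Q"
    then have "8 dvd b" using PQ(3) by auto
    then show False using mod_8(2) by presburger
  qed
  have mnpos: "0 < m + n" using m_pos n_pos by simp
  let ?M = "prime_factorization (nat c)"
  note M = prime_factorization_of_pos_int[OF pos(3)]
  have L1: "Legendre ((m + n) * int Q) p = 1" if "p \<in># ?M" for p
  proof -
    have p: "prime p" "int p dvd c" using M(2)[OF that] by auto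
    note pf = prime_factor_c[OF p]
    note Lm = Legendre_mult[OF p(1) pf(4)] and Lp = Legendre_power[OF p(1) pf(4)]
    have sq: "Legendre w p * Legendre w p = 1" if "\<not> int p dvd w" for w
      using Legendre_square[OF that] p(1) by (simp add: Lm power2_eq_square)
    have p2: "\<not> int p dvd 2" using pf(4) zdvd_not_zless[of 2 "int p"] by simp
    have pmn: "\<not> int p dvd m + n"
    proof
      assume "int p dvd m + n"
      then have "int p dvd (m + n)\<^sup>2 - c" using p(2) by (simp add: power2_eq_square)
      moreover have "(m + n)\<^sup>2 - c = b" by (simp add: b_def c_def power2_eq_square algebra_simps)
      ultimately show False using pf(3) by simp
    qed
    have pQ: "\<not> int p dvd int Q" using pf(3) unfolding PQ(3)[symmetric] by auto
    \<comment> \<open>Modulo \<open>p\<close>, the equation reads \<open>(m + n)\<^bsup>2 y\<^esup> = - (2\<^bsup>2 y - 1\<^esup> Q\<^bsup>y\<^esup>)\<^sup>2\<close> and \<open>- 1 = (m / n)\<^sup>2\<close>. The sign lost by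
      taking square roots does not matter because \<open>- 1\<close> is a square modulo \<open>p\<close>.\<close>
    let ?A = "m * (m + n) ^ y" and ?B = "n * (2 ^ (2 * y - 1) * int Q ^ y)"
    have "[b = (m + n)\<^sup>2] (mod p)"
    proof -
      have "(m + n)\<^sup>2 - b = c" by (simp add: b_def c_def power2_eq_square algebra_simps)
      then have "[(m + n)\<^sup>2 = b] (mod p)" using p(2) by (simp add: cong_iff_dvd_diff)
      then show ?thesis by (rule cong_sym)
    qed
    then have "[b ^ y = (m + n) ^ (2 * y)] (mod p)" unfolding power_mult by (rule cong_pow)
    moreover have "b ^ y = 4 ^ y * int Q ^ y * c ^ Z - (2 ^ (2 * y - 1) * int Q ^ y)\<^sup>2"
    proof -
      obtain k where k: "y = Suc k" using assms(4) by (cases y) auto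
      have "(2 :: int) ^ (2 * y - 1) * 2 ^ (2 * y - 1) = 4 ^ y * 4 ^ (y - 1)"
        unfolding k by (simp add: power_mult)
      then have "(2 ^ (2 * y - 1) * int Q ^ y)\<^sup>2 = 4 ^ y * int Q ^ y * (4 ^ (y - 1) * int Q ^ y)"
        by (simp add: power2_eq_square ac_simps)
      then show ?thesis unfolding PQ(2) PQ(3)[symmetric] by (simp add: power_mult_distrib algebra_simps)
    qed
    moreover have "int p dvd c ^ Z" using dvd_trans[OF p(2) dvd_power[of Z c]] Zpos by simp
    ultimately have "int p dvd (m + n) ^ (2 * y) - b ^ y" "int p dvd b ^ y + (2 ^ (2 * y - 1) * int Q ^ y)\<^sup>2"
      by (simp_all add: cong_sym flip: cong_iff_dvd_diff)
    then have "int p dvd ((m + n) ^ (2 * y) - b ^ y) + (b ^ y + (2 ^ (2 * y - 1) * int Q ^ y)\<^sup>2)"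
      by (rule dvd_add)
    then have "int p dvd (m + n) ^ (2 * y) + (2 ^ (2 * y - 1) * int Q ^ y)\<^sup>2"
      by simp
    then have "int p dvd m\<^sup>2 * ((m + n) ^ (2 * y) + (2 ^ (2 * y - 1) * int Q ^ y)\<^sup>2) - c * (2 ^ (2 * y - 1) * int Q ^ y)\<^sup>2"
      using p(2) by simp
    also have "m\<^sup>2 * ((m + n) ^ (2 * y) + (2 ^ (2 * y - 1) * int Q ^ y)\<^sup>2) - c * (2 ^ (2 * y - 1) * int Q ^ y)\<^sup>2
        = ?A\<^sup>2 - ?B\<^sup>2"
      by (simp add: c_def power_mult_distrib algebra_simps flip: power_mult)
    also have "\<dots> = (?A - ?B) * (?A + ?B)" by (simp add: power2_eq_square algebra_simps)
    finally have "int p dvd ?A - ?B \<or> int p dvd ?A + ?B"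
      using p(1) by (simp add: prime_dvd_mult_iff)
    then have "[?A = ?B] (mod p) \<or> [?A = - 1 * ?B] (mod p)" by (simp add: cong_iff_dvd_diff)
    then have "Legendre ?A p = Legendre ?B p"
    proof
      assume "[?A = - 1 * ?B] (mod p)"
      then have "Legendre ?A p = Legendre (- 1) p * Legendre ?B p" using Legendre_cong Lm by metis
      then show ?thesis using Legendre_neg1[OF p(1) pf(4)] pf(5) by simp
    qed (rule Legendre_cong)
    have oddpow: "Legendre w p ^ k = Legendre w p" if "odd k" "\<not> int p dvd w" for w k
    proof -
      have "Legendre w p \<in> {- 1, 1}" using Legendre_cases[of w p] Legendre_eq_0_iff[of w p] that(2) by auto
      then show ?thesis using that(1) by auto
    qed
    have "odd (2 * y - 1)" using assms(4) by simp
    then have "Legendre m p * Legendre (m + n) p = Legendre n p * (Legendre 2 p * Legendre (int Q) p)"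
      using \<open>Legendre ?A p = Legendre ?B p\<close> y oddpow p2 pQ pmn by (simp add: Lm Lp)
    moreover have "Legendre 2 p * Legendre m p * Legendre n p = 1" using pf(6) unfolding b_def Lm .
    moreover have "B * E = 1" if "A * B = C * (D * E)" "D * A * C = 1" "A * A = 1" "B * B = 1" for A B C D E :: int
    proof -
      have "B * E = (D * A * C) * (B * E)" using that(2) by simp
      also have "\<dots> = (A * B) * (C * (D * E))" by (simp only: ac_simps)
      also have "\<dots> = (A * A) * (B * B)" unfolding that(1)[symmetric] by (simp only: ac_simps)
      finally show ?thesis using that(3,4) by simp
    qed
    ultimately show ?thesis
      unfolding Lm using sq[OF pf(1)] sq[OF pmn] by blast
  qed
  have M1: "prime p \<and> p mod 4 = 1" if "p \<in># ?M" for p using M(2)[OF that] prime_factor_c(5) by blast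
  have "(\<Prod>p\<in>#?M. Legendre (m + n) (int p)) = - 1"
  proof -
    let ?N = "prime_factorization (nat (m + n))"
    note N = prime_factorization_of_pos_int[OF mnpos]
    have "(\<Prod>p\<in>#?M. Legendre (int (prod_mset ?N)) (int p)) = (\<Prod>q\<in>#?N. Legendre (int (prod_mset ?M)) (int q))"
    proof (rule Jacobi_reciprocity)
      fix p assume p: "p \<in># ?M"
      show "p \<notin># ?N"
      proof
        assume "p \<in># ?N"
        then have "int p dvd m + n" using N(2) by blast
        then have "Legendre ((m + n) * int Q) p = 0" by (simp add: Legendre_eq_0_iff)
        then show False using L1[OF p] by simp
      qed
    qed (use M1 N(2) mn8(2) in auto)
    also have "\<dots> = (\<Prod>q\<in>#?N. Legendre 2 (int q))"
    proof (intro arg_cong[of _ _ prod_mset] image_mset_cong)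
      fix q assume "q \<in># ?N"
      then have q: "prime q" "int q dvd m + n" using N(2) by auto
      note q' = mn8(2)[OF q]
      have "c - 2 * n\<^sup>2 = (m + n) * (m - n)" by (simp add: c_def power2_eq_square algebra_simps)
      then have "[c = 2 * n\<^sup>2] (mod q)" using q(2) by (simp add: cong_iff_dvd_diff)
      then have "Legendre c q = Legendre (2 * n\<^sup>2) q" by (rule Legendre_cong)
      also have "\<dots> = Legendre 2 q" using q' q(1) by (simp add: Legendre_mult Legendre_square)
      finally show "Legendre (int (prod_mset ?M)) (int q) = Legendre 2 (int q)" unfolding M(1) .
    qed
    also have "\<dots> = (if prod_mset ?N mod 8 = 1 then 1 else - 1)"
    proof -
      have "q mod 8 \<in> {1, 3} \<and> Legendre 2 (int q) = (if q mod 8 = 1 then 1 else - 1)" if "q \<in># ?N" for q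
        using N(2)[OF that] mn8(2)[of q] Legendre_2[of q] by auto
      then show ?thesis by (rule conjunct2[OF prod_mset_sign_mod_8])
    qed
    also have "\<dots> = - 1"
    proof -
      have "int (prod_mset ?N mod 8) = 3" using mn8(1) N(1) by (simp add: zmod_int)
      then show ?thesis by simp
    qed
    finally show ?thesis unfolding N(1) .
  qed
  moreover have "(\<Prod>p\<in>#?M. Legendre (int Q) (int p)) = 1"
  proof -
    let ?N = "prime_factorization Q"
    have NQ: "prod_mset ?N = Q" using Qpos by (simp add: prod_mset_prime_factorization_nat)
    have N: "prime q \<and> q dvd Q" if "q \<in># ?N" for q using that by (auto simp: in_prime_factors_iff)
    have N2: "2 < q" if "q \<in># ?N" for q
    proof -
      have "q \<noteq> 2" using N[OF that] oddQ by auto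
      then show ?thesis using N[OF that] prime_ge_2_nat[of q] by simp
    qed
    have "(\<Prod>p\<in>#?M. Legendre (int (prod_mset ?N)) (int p)) = (\<Prod>q\<in>#?N. Legendre (int (prod_mset ?M)) (int q))"
    proof (rule Jacobi_reciprocity)
      fix p assume p: "p \<in># ?M"
      show "p \<notin># ?N"
      proof
        assume "p \<in># ?N"
        then have "int p dvd int Q" using N by auto
        then have "Legendre ((m + n) * int Q) p = 0" by (simp add: Legendre_eq_0_iff)
        then show False using L1[OF p] by simp
      qed
    qed (use M1 N N2 in auto)
    also have "\<dots> = (\<Prod>q\<in>#?N. 1)"
    proof (intro arg_cong[of _ _ prod_mset] image_mset_cong)
      fix q assume q: "q \<in># ?N"
      have "int q dvd int Q" using N[OF q] by auto
      then have "int q dvd b" unfolding PQ(3)[symmetric] by simp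
      moreover have "\<not> int q dvd 2" using N2[OF q] zdvd_not_zless[of 2 "int q"] by simp
      ultimately have "int q dvd m \<or> int q dvd n"
        unfolding b_def using N[OF q] by (auto simp: prime_dvd_mult_iff)
      then have "Legendre c q = 1"
      proof
        assume d: "int q dvd m"
        then have "\<not> int q dvd n" using cop_mn N[OF q] by (metis coprime_common_divisor not_prime_unit prime_nat_int_transfer)
        moreover have "[c = n\<^sup>2] (mod q)" using d by (simp add: c_def cong_iff_dvd_diff power2_eq_square)
        ultimately show ?thesis using Legendre_cong Legendre_square N[OF q] by (metis prime_nat_int_transfer)
      next
        assume d: "int q dvd n"
        then have "\<not> int q dvd m" using cop_mn N[OF q] by (metis coprime_common_divisor not_prime_unit prime_nat_int_transfer)
        moreover have "[c = m\<^sup>2] (mod q)" using d by (simp add: c_def cong_iff_dvd_diff power2_eq_square)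
        ultimately show ?thesis using Legendre_cong Legendre_square N[OF q] by (metis prime_nat_int_transfer)
      qed
      then show "Legendre (int (prod_mset ?M)) (int q) = 1" unfolding M(1) .
    qed
    finally show ?thesis unfolding NQ by simp
  qed
  moreover have "(\<Prod>p\<in>#?M. Legendre ((m + n) * int Q) (int p)) = (\<Prod>p\<in>#?M. Legendre (m + n) (int p) * Legendre (int Q) (int p))"
    using M(2) prime_factor_c(4) by (intro arg_cong[of _ _ prod_mset] image_mset_cong Legendre_mult) auto
  moreover have "(\<Prod>p\<in>#?M. Legendre ((m + n) * int Q) (int p)) = (\<Prod>p\<in>#?M. 1)"
    using L1 by (intro arg_cong[of _ _ prod_mset] image_mset_cong) auto
  ultimately show False by (simp add: prod_mset.distrib)
qed

lemma a_gt_1: "1 < a"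
  using pos(1) mod_8(3) by presburger

lemma nat_forms: obtains A B C :: nat where "a = int A" "b = int B" "c = int C"
  using pos that by (metis less_imp_le zero_le_imp_eq_int)

text \<open>For \<open>y \<ge> 4\<close> the factor \<open>4 ^ (y - 1)\<close> vanishes modulo 8 and
  \<open>P ^ y\<close> is 1, so \<open>c ^ Z\<close> is 1 and \<open>a ^ X\<close> is 1 or 7. As
  \<open>c\<close> is 5 and \<open>a\<close> is 3 or 5, both \<open>Z\<close> and \<open>X\<close>
  are even. At \<open>y = 2\<close> the factor is only 4 and this argument stops.\<close>

lemma y_less_4:
  assumes eq: "a ^ x + b ^ y = c ^ z" and "0 < x" "0 < z" "even y" "2 \<le> y"
  shows "y < 4"
proof (rule ccontr)
  assume "\<not> y < 4"
  then have y: "4 \<le> y" by simp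
  obtain X Z Y where XZ: "x = 2 * X" "z = 2 * Z" "y = 2 * Y"
    using even_x[OF eq assms(3)] even_z[OF eq assms(3,5)] \<open>even y\<close> by (elim evenE)
  have Zpos: "0 < Z" using assms(3) XZ(2) by simp
  obtain P Q where PQ: "odd P" "c ^ Z = int P ^ y + 4 ^ (y - 1) * int Q ^ y"
    "a ^ X = int P ^ y - 4 ^ (y - 1) * int Q ^ y \<or> - (a ^ X) = int P ^ y - 4 ^ (y - 1) * int Q ^ y"
    "4 * (int P * int Q) = b"
    by (rule coprime_power_split[OF eq[unfolded XZ(1,2)] Zpos assms(5)])
  have P8: "int P ^ y mod 8 = 1" using PQ(1) \<open>even y\<close> by (intro odd_square_power_mod_8) auto
  have "(4 :: int) ^ 2 dvd 4 ^ (y - 1)" using y by (intro le_imp_power_dvd) simp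
  then have "(8 :: int) dvd 4 ^ (y - 1)" by (rule dvd_trans[rotated]) simp
  then have d8: "8 dvd 4 ^ (y - 1) * int Q ^ y" by simp
  have residues: "(u + v) mod 8 = 1" "(u - v) mod 8 = 1" if "u mod 8 = 1" "8 dvd v" for u v :: int
    using that by (simp_all add: mod_add_eq[of u 8 v, symmetric] mod_diff_eq[of u 8 v, symmetric] dvd_imp_mod_0 del: mod_add_eq mod_diff_eq)
  have minus: "w mod 8 = 7" if "- w mod 8 = 1" for w :: int
    using that by presburger
  have c8: "c ^ Z mod 8 = 1" unfolding PQ(2) by (rule residues(1)[OF P8 d8])
  have a8: "a ^ X mod 8 = 1 \<or> a ^ X mod 8 = 7" using PQ(3) residues(2)[OF P8 d8] minus by metis
  have "even Z"
  proof (rule ccontr)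
    assume "odd Z"
    then show False using odd_power_mod_8[OF odd_a_c(2)] c8 mod_8(1) by simp
  qed
  moreover have "even X"
  proof (rule ccontr)
    assume "odd X"
    then show False using odd_power_mod_8[OF odd_a_c(1)] a8 mod_8(3) by auto
  qed
  ultimately obtain X' Z' where XZ': "X = 2 * X'" "Z = 2 * Z'" by (elim evenE)
  obtain A B C where ABC: "a = int A" "b = int B" "c = int C" by (rule nat_forms)
  have "int ((C ^ Z') ^ 4) = int ((A ^ X') ^ 4 + (B ^ Y) ^ 2)"
    using eq unfolding XZ XZ' ABC by (simp add: mult.commute flip: power_mult)
  then have "(C ^ Z') ^ 4 = (A ^ X') ^ 4 + (B ^ Y) ^ 2" by (simp only: of_nat_eq_iff)
  moreover have "coprime (C ^ Z') (A ^ X')" using coprime_ca unfolding ABC by simp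
  moreover have "0 < A ^ X'" using pos ABC by auto
  moreover have "even (B ^ Y)"
  proof -
    have "even b" using mod_8(2) by presburger
    then show ?thesis using ABC(2) y XZ(3) by auto
  qed
  moreover have "0 < B ^ Y" using pos ABC by auto
  ultimately show False by (rule biquadrate_difference_not_square)
qed

text \<open>At \<open>y = 2\<close> the factor \<open>c ^ Z - a ^ X\<close> of \<open>b^2\<close> is
  at least 1, so \<open>c ^ Z < c ^ Z + a ^ X \<le> b^2 < c^2\<close>, which leaves
  \<open>Z = 1\<close>.\<close>

lemma solution_y_ge_2:
  assumes eq: "a ^ x + b ^ y = c ^ z" and "0 < x" "0 < z" "2 \<le> y"
  shows "x = 2 \<and> y = 2 \<and> z = 2"
proof -
  have "even y" using y_not_odd[OF eq assms(2-4)] .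
  then have y: "y = 2" using y_less_4[OF eq assms(2,3) _ assms(4)] assms(4) by presburger
  obtain X Z where XZ: "x = 2 * X" "z = 2 * Z"
    using even_x[OF eq assms(3)] even_z[OF eq assms(3,4)] by (elim evenE)
  have bc: "b\<^sup>2 < c\<^sup>2" using pythagoras pos(1) zero_less_power[of a 2] by linarith
  have fact: "(c ^ Z - a ^ X) * (c ^ Z + a ^ X) = b\<^sup>2"
    using eq unfolding XZ y mult_2 power_add by (simp add: algebra_simps)
  have p: "0 < c ^ Z" "0 < a ^ X" using pos by simp_all
  have "0 < (c ^ Z - a ^ X) * (c ^ Z + a ^ X)" unfolding fact using pos(2) by simp
  then have "1 \<le> c ^ Z - a ^ X" using p by (simp add: zero_less_mult_iff)
  then have "1 * (c ^ Z + a ^ X) \<le> b\<^sup>2" unfolding fact[symmetric] using p by (intro mult_right_mono) auto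
  then have "c ^ Z < c ^ 2" using p bc by simp
  then have "Z < 2" using pos(3) power_increasing[of 2 Z c] by (metis int_one_le_iff_zero_less linorder_not_le)
  then have Z: "Z = 1" using assms(3) XZ by simp
  have "a ^ (2 * X) = a ^ 2" using eq pythagoras unfolding XZ y Z by simp
  then have "2 * X = 2" using a_gt_1 by (metis power_inject_exp)
  then show ?thesis using XZ y Z by simp
qed

section \<open>The case y = 1\<close>

text \<open>If \<open>x \<le> z\<close>, then
  \<open>b = c^z - a^x \<ge> c^x - a^x \<ge> c^2 - a^2 = b^2\<close>, as \<open>x\<close> is even
  and positive.\<close>

lemma x_gt_z:
  assumes eq: "a ^ x + b = c ^ z" and "0 < x" "0 < z"
  shows "z < x"
proof (rule ccontr)
  assume "\<not> z < x"
  obtain X where X: "x = 2 * X" using even_x[of x 1 z] eq assms(3) by auto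
  have "c ^ x \<le> c ^ z" using \<open>\<not> z < x\<close> pos(3) by (intro power_increasing) auto
  moreover have "c\<^sup>2 - a\<^sup>2 \<le> (c\<^sup>2) ^ X - (a\<^sup>2) ^ X"
  proof (rule power_diff_ge)
    have "a \<le> c" by (simp add: a_def c_def)
    then show "a\<^sup>2 \<le> c\<^sup>2" using pos by (intro power_mono) auto
  qed (use X assms(2) pos in auto)
  ultimately have "b\<^sup>2 \<le> b" using eq pythagoras unfolding X power_mult by linarith
  moreover have "4 \<le> b" using mod_8(2) pos(2) by presburger
  then have "4 * b \<le> b\<^sup>2" by (simp add: power2_eq_square)
  ultimately show False using pos(2) by linarith
qed

text \<open>A nontrivial gcd \<open>d\<close> is odd because \<open>z\<close> is, hence at least 3.
  The two \<open>d\<close>-th powers then differ by at least \<open>a ^ (2 * x')\<close>, which is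
  at least \<open>a^2 \<ge> (m + n)^2 = b + c > b\<close>.\<close>

lemma coprime_xz:
  assumes eq: "a ^ x + b = c ^ z" and "0 < x" "0 < z"
  shows "coprime x z"
proof (rule ccontr)
  assume "\<not> coprime x z"
  define d where "d = gcd x z"
  have "odd z" using odd_z[OF eq assms(3)] .
  then have "odd d" unfolding d_def by (meson dvd_trans gcd_dvd2)
  moreover have "d \<noteq> 1" using \<open>\<not> coprime x z\<close> unfolding d_def coprime_iff_gcd_eq_1 .
  ultimately have d: "3 \<le> d" by presburger
  have "d dvd x" "d dvd z" unfolding d_def by simp_all
  then obtain x' z' where xz: "x = d * x'" "z = d * z'" by (elim dvdE)
  have "even x" using even_x[of x 1 z] eq assms(3) by auto
  then have "even x'" using xz(1) \<open>odd d\<close> by simp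
  then have x': "2 \<le> x'" using assms(2) xz(1) by (cases "x' = 0") (auto elim!: evenE)
  have "(a ^ x') ^ d < (c ^ z') ^ d"
    using eq pos(2) unfolding xz by (simp add: mult.commute flip: power_mult)
  then have lt: "a ^ x' < c ^ z'" by (rule power_less_imp_less_base) (use pos in simp)
  have "(a ^ x')\<^sup>2 \<le> (c ^ z') ^ d - (a ^ x') ^ d"
    by (rule power_diff_ge_square[OF _ lt d]) (use pos in simp)
  also have "\<dots> = b" using eq unfolding xz by (simp add: mult.commute flip: power_mult)
  finally have "a ^ (x' * 2) \<le> b" unfolding power_mult .
  then have "a ^ (2 * x') \<le> b" by (simp only: mult.commute)
  moreover have "a ^ 2 \<le> a ^ (2 * x')" using x' pos(1) by (intro power_increasing) auto
  moreover have "(m + n) ^ 2 \<le> a ^ 2"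
  proof -
    have "1 * (m + n) \<le> (m - n) * (m + n)" using n_less_m n_pos by (intro mult_right_mono) auto
    then show ?thesis unfolding a_factor using n_less_m n_pos by (intro power_mono) auto
  qed
  moreover have "(m + n) ^ 2 = b + c" by (simp add: b_def c_def power2_eq_square algebra_simps)
  ultimately show False using pos(3) by linarith
qed

text \<open>Since \<open>x\<close> is even and \<open>a^2 \<equiv> c^2\<close> modulo
  \<open>b^2\<close>, \<open>b^2\<close> divides \<open>c^x - a^x = c^z (c - 1) + b\<close>. So
  \<open>b\<close> divides \<open>c - 1\<close>, hence also \<open>c^z - 1\<close>; subtracting
  \<open>(c^z - 1) (c - 1)\<close> shows that \<open>b^2\<close> divides
  \<open>(m + n)^2 - 1\<close>, which is positive and below \<open>b^2\<close>.\<close>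

lemma x_minus_z_ne_1:
  assumes eq: "a ^ x + b = c ^ z" and "0 < x" "0 < z"
  shows "x \<noteq> z + 1"
proof
  assume xz: "x = z + 1"
  obtain X where X: "x = 2 * X" using even_x[of x 1 z] eq assms(3) by auto
  have "[(a\<^sup>2) ^ X = (c\<^sup>2) ^ X] (mod b\<^sup>2)"
  proof (rule cong_pow)
    have "[c\<^sup>2 = a\<^sup>2] (mod b\<^sup>2)" unfolding pythagoras[symmetric] by (simp add: cong_iff_dvd_diff)
    then show "[a\<^sup>2 = c\<^sup>2] (mod b\<^sup>2)" by (rule cong_sym)
  qed
  then have "[c ^ x = a ^ x] (mod b\<^sup>2)"
    unfolding X power_mult by (rule cong_sym)
  then have "b\<^sup>2 dvd c ^ x - a ^ x"
    unfolding cong_iff_dvd_diff .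
  also have "c ^ x - a ^ x = c ^ z * (c - 1) + b"
    using eq unfolding xz by (simp add: algebra_simps)
  finally have 1: "b\<^sup>2 dvd c ^ z * (c - 1) + b" .
  then have "b dvd c ^ z * (c - 1) + b" by (meson dvd_trans dvd_power pos2)
  then have "b dvd c ^ z * (c - 1)" by simp
  moreover have "coprime b (c ^ z)" using coprime_cb by (simp add: coprime_commute)
  ultimately have bc: "b dvd c - 1" by (simp add: coprime_dvd_mult_right_iff)
  then have "[c ^ z = 1 ^ z] (mod b)" by (intro cong_pow) (simp add: cong_iff_dvd_diff)
  then have "b dvd c ^ z - 1" by (simp add: cong_iff_dvd_diff)
  then have "b * b dvd (c ^ z - 1) * (c - 1)" using bc by (rule mult_dvd_mono)
  then have "b\<^sup>2 dvd (c ^ z * (c - 1) + b) - (c ^ z - 1) * (c - 1)"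
    using 1 by (simp add: power2_eq_square)
  also have "(c ^ z * (c - 1) + b) - (c ^ z - 1) * (c - 1) = (m + n)\<^sup>2 - 1"
    by (simp add: b_def c_def power2_eq_square algebra_simps)
  finally have 2: "b\<^sup>2 dvd (m + n)\<^sup>2 - 1" .
  have "2 \<le> m + n" using m_pos n_pos by simp
  then have "2 ^ 2 \<le> (m + n)\<^sup>2" by (intro power_mono) auto
  moreover have "(m + n)\<^sup>2 \<le> b\<^sup>2"
  proof -
    have "0 \<le> (m - 1) * (n - 1) + (m * n - 1)" using m_pos n_pos mult_mono[of 1 m 1 n] by simp
    then have "m + n \<le> b" by (simp add: b_def algebra_simps)
    then show ?thesis using m_pos n_pos by (intro power_mono) auto
  qed
  ultimately show False using 2 zdvd_not_zless[of "(m + n)\<^sup>2 - 1" "b\<^sup>2"] by simp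
qed

text \<open>From \<open>m / n > 30.8\<close> follows
  \<open>c / a = 1 + 2 / ((m / n)^2 - 1) < 1 + 2 / 947.6 < 1.00212\<close>, and
  \<open>m \<ge> 31\<close> makes \<open>a\<close> exceed 405. The difference \<open>t\<close> is
  odd because \<open>x\<close> is even and \<open>z\<close> is odd, so excluding 1 leaves
  \<open>t \<ge> 3\<close>.\<close>

lemma no_solution_y_1:
  assumes eq: "a ^ x + b = c ^ z" and "0 < x" "0 < z" and large: "308 * n < 10 * m"
  shows False
proof -
  define t where "t = x - z"
  have x: "x = z + t" using x_gt_z[OF assms(1-3)] by (simp add: t_def)
  have "odd z" using odd_z[OF eq assms(3)] .
  moreover have "even x" using even_x[of x 1 z] eq assms(3) by auto
  ultimately have "odd t" using x by auto
  moreover have "t \<noteq> 1" using x_minus_z_ne_1[OF assms(1-3)] x by auto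
  ultimately have t: "3 \<le> t" by presburger
  have cop: "coprime z t"
  proof -
    have "coprime z (z + t)" using coprime_xz[OF assms(1-3)] unfolding x by (simp only: coprime_commute)
    then show ?thesis unfolding coprime_iff_gcd_eq_1 gcd_add2 .
  qed
  obtain A B C where ABC: "a = int A" "b = int B" "c = int C" by (rule nat_forms)
  have "int (C ^ z) = int (A ^ (z + t) + B)" using eq unfolding ABC x by simp
  then have e: "C ^ z = A ^ (z + t) + B" by (simp only: of_nat_eq_iff)
  have n1: "1 \<le> n" using n_pos by simp
  have nn: "n * n \<le> m * n" using n_less_m n_pos by (intro mult_right_mono) auto
  have mm: "308 * (m * n) \<le> 10 * (m * m)"
    using mult_left_mono[of "308 * n" "10 * m" m] large m_pos by (simp add: algebra_simps)
  have mn: "308 * (n * n) \<le> 10 * (m * n)"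
    using mult_right_mono[of "308 * n" "10 * m" n] large n_pos by (simp add: algebra_simps)
  have m31: "31 \<le> m" using large n1 by linarith
  then have m31': "31 * 31 \<le> m * m" by (intro mult_mono) auto
  have "405 \<le> a" using m31' mn mm by (simp add: a_def power2_eq_square)
  moreover have "a < c" using n_pos by (simp add: a_def c_def)
  moreover have "100000 * c \<le> 100212 * a"
    using mn mm m31' by (simp add: a_def c_def power2_eq_square)
  moreover have "b \<le> a" using mn mm m31' by (simp add: a_def b_def power2_eq_square)
  ultimately have "405 \<le> A" "A < C" "100000 * C \<le> 100212 * A" "B \<le> A"
    unfolding ABC by linarith+
  moreover have "real C \<le> 100212 / 100000 * real A"
    using \<open>100000 * C \<le> 100212 * A\<close> by linarith
  moreover have "0 < B" using pos(2) ABC(2) by simp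
  ultimately show False
    using power_gap_impossible[where a = A and b = B and c = C and z = z and t = t] t cop e by simp
qed

end

theorem theorem1p1:
  fixes m n :: int
  assumes "m > 0" and "n > 0"
    and "m > n"
    and "gcd m n = 1"
    and "\<not> [m = n] (mod 2)"
    and "[m * n = 2] (mod 4)"
    and "real_of_int m > 30.8 * real_of_int n"
  shows "{(x :: nat, y :: nat, z :: nat). x > 0 \<and> y > 0 \<and> z > 0 \<and>
            (m\<^sup>2 - n\<^sup>2) ^ x + (2 * m * n) ^ y = (m\<^sup>2 + n\<^sup>2) ^ z} = {(2, 2, 2)}"
proof -
  interpret jesmanowicz_triple m n "m\<^sup>2 - n\<^sup>2" "2 * m * n" "m\<^sup>2 + n\<^sup>2"
    using assms by unfold_locales (auto simp: cong_def)
  have large: "308 * n < 10 * m"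
    using assms(7) by linarith
  have "x = 2 \<and> y = 2 \<and> z = 2"
    if "0 < x" "0 < y" "0 < z" and eq: "(m\<^sup>2 - n\<^sup>2) ^ x + (2 * m * n) ^ y = (m\<^sup>2 + n\<^sup>2) ^ z" for x y z
  proof (cases "y = 1")
    case True
    then show ?thesis using no_solution_y_1[of x z] that large by simp
  next
    case False
    then show ?thesis using solution_y_ge_2[OF eq] that by simp
  qed
  then show ?thesis using pythagoras by auto
qed

end
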